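(* Let $n\ge1$. A subgroup $H$ of $\mathrm{Iso}_0(\mathbb{P}^n(\mathbb{C}))$ is a MASG (maximal Abelian subgroup) if and only if there exists $\varphi\in\mathrm{Iso}_0(\mathbb{P}^n(\mathbb{C}))$ such that $\varphi H\varphi^{-1}=\mathbb{A}(n)$.
   Context: $\mathrm{Iso}_0(\mathbb{P}^n(\mathbb{C}))$ is the identity component of the isometry group of $\mathbb{P}^n(\mathbb{C})$ for the Fubini–Study metric; it is identified with $\mathrm{PSU}(n+1)=\mathrm{SU}(n+1)/\{\zeta I:\zeta^{n+1}=1\}$ acting by $\lambda(A)[w]=[Aw]$, where $\lambda:\mathrm{SU}(n+1)\to\mathrm{PSU}(n+1)$ is the quotient map. $\mathbb{A}(n)$ is the image under $\lambda$ of the group of diagonal matrices in $\mathrm{SU}(n+1)$. A MASG of a connected Lie group $G$ is a connected Abelian subgroup $H$ of $G$ that is maximal with respect to inclusion among connected Abelian subgroups of $G$. *)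

theory Defs
  imports "HOL-Analysis.Analysis" "HOL-Algebra.Coset"
begin

section \<open>Complex projective space with the Fubini--Study metric\<close>

definition cinner :: "complex^'n \<Rightarrow> complex^'n \<Rightarrow> complex" where
  "cinner v w = (\<Sum>i\<in>UNIV. v $ i * cnj (w $ i))"

lemma cinner_add_left: "cinner (u + v) w = cinner u w + cinner v w"
  by (simp add: cinner_def algebra_simps sum.distrib)

lemma cinner_diff_left: "cinner (u - v) w = cinner u w - cinner v w"
  by (simp add: cinner_def algebra_simps sum_subtractf)

lemma cinner_scale_left: "cinner (c *s v) w = c * cinner v w"
  by (simp add: cinner_def sum_distrib_left mult.assoc)

lemma cinner_commute: "cinner w v = cnj (cinner v w)"
  by (simp add: cinner_def mult.commute)

lemma cinner_diff_right: "cinner w (u - v) = cinner w u - cinner w v"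
  by (simp add: cinner_def algebra_simps sum_subtractf)

lemma cinner_scale_right: "cinner v (c *s w) = cnj c * cinner v w"
  by (simp add: cinner_def sum_distrib_left mult.left_commute)

lemma cinner_self: "cinner v v = complex_of_real ((norm v)\<^sup>2)"
  by (simp add: cinner_def norm_vec_def L2_set_def sum_nonneg complex_norm_square
      del: of_real_power)

lemma norm_scale_vec: "norm (c *s v) = cmod c * norm (v :: complex^'n)"
  by (simp add: norm_vec_def norm_mult L2_set_right_distrib)

lemma cinner_Cauchy_Schwarz: "cmod (cinner v w) \<le> norm v * norm w"
proof -
  have "cmod (cinner v w) \<le> (\<Sum>i\<in>UNIV. \<bar>cmod (v $ i)\<bar> * \<bar>cmod (w $ i)\<bar>)"
    unfolding cinner_def by (rule order_trans[OF norm_sum]) (simp add: norm_mult)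
  also have "\<dots> \<le> norm v * norm w"
    unfolding norm_vec_def by (rule L2_set_mult_ineq)
  finally show ?thesis .
qed

definition hom_rel :: "complex^'n \<Rightarrow> complex^'n \<Rightarrow> bool" where
  "hom_rel v w \<longleftrightarrow> v \<noteq> 0 \<and> w \<noteq> 0 \<and> (\<exists>c. w = c *s v)"

lemma hom_rel_nonzero:
  assumes "hom_rel v w" obtains c where "w = c *s v" "c \<noteq> 0" "v \<noteq> 0" "w \<noteq> 0"
  using assms unfolding hom_rel_def by (metis vector_smult_lzero)

lemma part_equivp_hom_rel: "part_equivp (hom_rel :: complex^'n \<Rightarrow> _)"
proof (rule part_equivpI)
  have "hom_rel (axis undefined 1 :: complex^'n) (axis undefined 1)"
    unfolding hom_rel_def by (metis axis_eq_0_iff one_neq_zero vector_smult_lid)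
  then show "\<exists>x::complex^'n. hom_rel x x" by blast
  show "symp (hom_rel :: complex^'n \<Rightarrow> _)"
  proof (rule sympI)
    fix v w :: "complex^'n" assume "hom_rel v w"
    then obtain c where c: "w = c *s v" "c \<noteq> 0" "v \<noteq> 0" "w \<noteq> 0" by (rule hom_rel_nonzero)
    then have "v = (1 / c) *s w" by (simp add: vector_smult_assoc)
    with c show "hom_rel w v" unfolding hom_rel_def by blast
  qed
  show "transp (hom_rel :: complex^'n \<Rightarrow> _)"
    unfolding hom_rel_def by (rule transpI) (metis vector_smult_assoc)
qed

text \<open>If \<open>CARD('n) = n + 1\<close>, then \<open>'n cproj\<close> is the projective space of
  complex dimension \<open>n\<close>, and \<^term>\<open>abs_cproj w\<close> is the point \<open>[w]\<close> when \<open>w \<noteq> 0\<close>.\<close>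

quotient_type 'n cproj = "complex^'n" / partial: hom_rel
  by (rule part_equivp_hom_rel)

lemma rep_cproj_nonzero: "rep_cproj p \<noteq> 0"
  using Quotient_rep_reflp[OF Quotient_cproj, of p] by (simp add: hom_rel_def)

lemma abs_rep_cproj: "abs_cproj (rep_cproj p) = p"
  by (rule Quotient_abs_rep[OF Quotient_cproj])

lemma abs_cproj_eq_iff:
  assumes "v \<noteq> 0" "w \<noteq> 0"
  shows "abs_cproj v = abs_cproj w \<longleftrightarrow> (\<exists>c. w = c *s v)"
proof -
  have "u \<noteq> 0 \<Longrightarrow> hom_rel u u" for u :: "complex^'n"
    unfolding hom_rel_def by (metis vector_smult_lid)
  then have "hom_rel v w \<longleftrightarrow> abs_cproj v = abs_cproj w"
    using Quotient_rel[OF Quotient_cproj, of v w] assms by blast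
  then show ?thesis using assms by (simp add: hom_rel_def)
qed

lemma fs_ratio_bounds: "0 \<le> cmod (cinner v w) / (norm v * norm w)"
  "cmod (cinner v w) / (norm v * norm w) \<le> 1"
  using cinner_Cauchy_Schwarz[of v w]
  by (auto simp: divide_le_eq_1 zero_less_mult_iff)

lemma fs_ratio_scale:
  assumes "c \<noteq> 0" "d \<noteq> 0"
  shows "cmod (cinner (c *s v) (d *s w)) / (norm (c *s v) * norm (d *s w))
    = cmod (cinner v w) / (norm v * norm w)"
  using assms by (simp add: cinner_scale_left cinner_scale_right norm_mult norm_scale_vec)

lemma fs_unit_triangle:
  fixes x y z :: "complex^'n"
  assumes "norm x = 1" "norm y = 1" "norm z = 1"
  shows "arccos (cmod (cinner x z)) \<le> arccos (cmod (cinner x y)) + arccos (cmod (cinner y z))"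
proof -
  define a where "a = cmod (cinner x y)"
  define b where "b = cmod (cinner y z)"
  define p where "p = x - cinner x y *s y"
  define q where "q = z - cinner z y *s y"
  have le1: "cmod (cinner u v) \<le> 1" if "norm u = 1" "norm v = 1" for u v :: "complex^'n"
    using cinner_Cauchy_Schwarz[of u v] that by simp
  have ab: "0 \<le> a" "a \<le> 1" "0 \<le> b" "b \<le> 1"
    using le1 assms by (auto simp: a_def b_def)
  have self: "cinner u u = 1" if "norm u = 1" for u :: "complex^'n"
    using that by (simp add: cinner_self)
  have pq: "cinner p q = cinner x z - cinner x y * cinner y z"
    using self[of y] assms cinner_commute[of z y]
    by (simp add: p_def q_def cinner_diff_left cinner_diff_right cinner_scale_left
        cinner_scale_right algebra_simps)
  have orth: "(norm (u - cinner u y *s y))\<^sup>2 = 1 - (cmod (cinner u y))\<^sup>2"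
    if "norm u = 1" for u :: "complex^'n"
  proof -
    have "complex_of_real ((norm (u - cinner u y *s y))\<^sup>2)
        = 1 - cinner u y * cnj (cinner u y)"
      unfolding cinner_self[symmetric]
      using self[of y] self[of u] that assms cinner_commute[of y u]
      by (simp add: cinner_diff_left cinner_diff_right cinner_scale_left
        cinner_scale_right algebra_simps)
    also have "\<dots> = complex_of_real (1 - (cmod (cinner u y))\<^sup>2)"
      by (simp add: complex_norm_square[symmetric])
    finally show ?thesis by (simp only: of_real_eq_iff)
  qed
  have bz: "cmod (cinner z y) = b"
    unfolding b_def by (subst cinner_commute) simp
  have np: "norm p = sqrt (1 - a\<^sup>2)" "norm q = sqrt (1 - b\<^sup>2)"
    using orth[of x] orth[of z] assms
    by (metis a_def p_def norm_ge_zero real_sqrt_unique,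
        metis bz q_def norm_ge_zero real_sqrt_unique)
  have "a * b - cmod (cinner x z) \<le> cmod (cinner p q)"
    unfolding pq a_def b_def norm_mult[symmetric]
    by (metis norm_minus_commute norm_triangle_ineq2)
  also have "\<dots> \<le> norm p * norm q" by (rule cinner_Cauchy_Schwarz)
  finally have "a * b - sqrt (1 - a\<^sup>2) * sqrt (1 - b\<^sup>2) \<le> cmod (cinner x z)"
    by (simp add: np)
  then have "cos (arccos a + arccos b) \<le> cmod (cinner x z)"
    using ab by (simp add: cos_add sin_arccos)
  then have "arccos (cmod (cinner x z)) \<le> arccos (cos (arccos a + arccos b))"
    using le1 assms by (intro arccos_le_arccos) auto
  also have "\<dots> = arccos a + arccos b"
    using ab arccos_le_pi2[of a] arccos_le_pi2[of b] arccos_lbound[of a] arccos_lbound[of b]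
    by (intro arccos_cos) auto
  finally show ?thesis by (simp add: a_def b_def)
qed

text \<open>The geodesic distance of the Fubini--Study Riemannian metric (up to a constant factor).
  By the Myers--Steenrod theorem the Riemannian isometries are exactly the bijections preserving it.\<close>

instantiation cproj :: (finite) metric_space
begin

lift_definition dist_cproj :: "'a cproj \<Rightarrow> 'a cproj \<Rightarrow> real" is
  "\<lambda>v w. arccos (cmod (cinner v w) / (norm v * norm w))"
  by (elim hom_rel_nonzero) (metis fs_ratio_scale)

definition uniformity_cproj :: "('a cproj \<times> 'a cproj) filter" where
  "uniformity_cproj = (INF e\<in>{0<..}. principal {(x, y). dist x y < e})"

definition open_cproj :: "'a cproj set \<Rightarrow> bool" where
  "open_cproj U = (\<forall>x\<in>U. \<forall>\<^sub>F (x', y) in uniformity. x' = x \<longrightarrow> y \<in> U)"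

instance
proof
  have unit: "\<exists>v. norm v = 1 \<and> p = abs_cproj v" for p :: "'a cproj"
  proof -
    let ?v = "rep_cproj p"
    let ?u = "complex_of_real (1 / norm ?v) *s ?v"
    have nz: "?v \<noteq> 0" by (rule rep_cproj_nonzero)
    have n1: "norm ?u = 1" using nz by (simp add: norm_scale_vec norm_divide)
    then have "?u \<noteq> 0" by (metis norm_zero zero_neq_one)
    then have "abs_cproj ?v = abs_cproj ?u" using nz abs_cproj_eq_iff by blast
    with n1 show ?thesis by (metis abs_rep_cproj)
  qed
  have d: "dist (abs_cproj v) (abs_cproj w) = arccos (cmod (cinner v w))"
    if "norm v = 1" "norm w = 1" for v w :: "complex^'a"
  proof -
    have "hom_rel u u" if "norm u = 1" for u :: "complex^'a"
      using that unfolding hom_rel_def by (metis norm_zero vector_smult_lid zero_neq_one)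
    then show ?thesis using that by (simp add: dist_cproj.abs_eq)
  qed
  fix x y z :: "'a cproj"
  obtain u v w where uvw: "norm u = 1" "x = abs_cproj u" "norm v = 1" "y = abs_cproj v"
    "norm w = 1" "z = abs_cproj w"
    using unit by meson
  have nz: "u \<noteq> 0" "v \<noteq> 0" using uvw by auto
  have le1: "cmod (cinner u v) \<le> 1" using cinner_Cauchy_Schwarz[of u v] uvw by simp
  show "dist x y = 0 \<longleftrightarrow> x = y"
  proof
    assume "dist x y = 0"
    then have "arccos (cmod (cinner u v)) = 0" using uvw d by simp
    then have 1: "cmod (cinner u v) = 1"
      using le1 by (metis arccos_eq_0_iff cos_arccos_abs cos_zero abs_norm_cancel)
    have "complex_of_real ((norm (u - cinner u v *s v))\<^sup>2) = 1 - cinner u v * cnj (cinner u v)"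
      unfolding cinner_self[symmetric]
      using cinner_self[of v] cinner_self[of u] uvw cinner_commute[of v u]
      by (simp add: cinner_diff_left cinner_diff_right cinner_scale_left
        cinner_scale_right algebra_simps)
    also have "\<dots> = 0" using 1 by (simp add: complex_norm_square[symmetric])
    finally have "u = cinner u v *s v" by simp
    then show "x = y" using uvw nz abs_cproj_eq_iff[of v u] by metis
  next
    assume "x = y"
    then show "dist x y = 0" using uvw(1,2) d[of u u] by (simp add: cinner_self)
  qed
  have "dist x y \<le> dist x z + dist z y"
    using fs_unit_triangle[of u w v] uvw d by simp
  moreover have "dist z y = dist y z"
    using uvw d by (simp, metis cinner_commute complex_mod_cnj)
  ultimately show "dist x y \<le> dist x z + dist y z" by simp
qed (rule uniformity_cproj_def open_cproj_def)+

end

lemma dist_abs_cproj: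
  assumes "v \<noteq> 0" "w \<noteq> 0"
  shows "dist (abs_cproj v) (abs_cproj w) = arccos (cmod (cinner v w) / (norm v * norm w))"
proof -
  have "hom_rel u u" if "u \<noteq> 0" for u :: "complex^'n"
    using that unfolding hom_rel_def by (metis vector_smult_lid)
  then show ?thesis using assms by (metis dist_cproj.abs_eq)
qed


section \<open>The isometry group and its identity component\<close>

definition isometries :: "('a::metric_space \<Rightarrow> 'a) set" where
  "isometries = {f. bij f \<and> (\<forall>x y. dist (f x) (f y) = dist x y)}"

definition isometry_group :: "('a::metric_space \<Rightarrow> 'a) monoid" where
  "isometry_group = \<lparr>carrier = isometries, mult = (\<circ>), one = id\<rparr>"

lemma group_isometry_group: "group isometry_group"
proof (rule groupI)
  fix f :: "'a \<Rightarrow> 'a" assume "f \<in> carrier isometry_group"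
  then have f: "bij f" "\<And>x y. dist (f x) (f y) = dist x y"
    by (auto simp: isometry_group_def isometries_def)
  have "dist (inv_into UNIV f x) (inv_into UNIV f y) = dist x y" for x y
    using f by (metis bij_inv_eq_iff)
  then have "inv_into UNIV f \<in> carrier isometry_group"
    using f by (simp add: isometry_group_def isometries_def bij_imp_bij_inv)
  moreover have "inv_into UNIV f \<circ> f = id" using f by (simp add: bij_is_inj)
  ultimately show "\<exists>g\<in>carrier isometry_group. g \<otimes>\<^bsub>isometry_group\<^esub> f = \<one>\<^bsub>isometry_group\<^esub>"
    by (auto simp: isometry_group_def)
qed (auto simp: isometry_group_def isometries_def bij_comp comp_assoc)

text \<open>The topology of the isometry group (a Lie group in the Riemannian case) is the
  compact-open topology. Below it is always restricted to sets of isometries, hence to continuous maps.\<close>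

definition compact_open :: "('a::topological_space \<Rightarrow> 'b::topological_space) topology" where
  "compact_open = topology_generated_by {{f. f ` K \<subseteq> U} | K U. compact K \<and> open U}"

definition Iso0 :: "('a::metric_space \<Rightarrow> 'a) monoid" where
  "Iso0 = isometry_group
     \<lparr>carrier := connected_component_of_set (subtopology compact_open isometries) id\<rparr>"

definition Iso0_top :: "('a::metric_space \<Rightarrow> 'a) topology" where
  "Iso0_top = subtopology compact_open (carrier Iso0)"


section \<open>Maximal connected Abelian subgroups\<close>

definition connected_abelian_subgroup ::
    "('g, 'm) monoid_scheme \<Rightarrow> 'g topology \<Rightarrow> 'g set \<Rightarrow> bool" where
  "connected_abelian_subgroup G T H \<longleftrightarrow>
     subgroup H G \<and> (\<forall>x\<in>H. \<forall>y\<in>H. x \<otimes>\<^bsub>G\<^esub> y = y \<otimes>\<^bsub>G\<^esub> x) \<and> connectedin T H"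

definition masg :: "('g, 'm) monoid_scheme \<Rightarrow> 'g topology \<Rightarrow> 'g set \<Rightarrow> bool" where
  "masg G T H \<longleftrightarrow> connected_abelian_subgroup G T H \<and>
     (\<forall>K. connected_abelian_subgroup G T K \<and> H \<subseteq> K \<longrightarrow> K = H)"


section \<open>The special unitary group and its diagonal subgroup\<close>

definition adjoint_mat :: "complex^'n^'n \<Rightarrow> complex^'n^'n" where
  "adjoint_mat A = (\<chi> i j. cnj (A $ j $ i))"

definition SU :: "(complex^'n^'n) set" where
  "SU = {A. A ** adjoint_mat A = mat 1 \<and> det A = 1}"

definition diagonal_SU :: "(complex^'n^'n) set" where
  "diagonal_SU = {A \<in> SU. \<forall>i j. i \<noteq> j \<longrightarrow> A $ i $ j = 0}"

text \<open>The action \<open>[w] \<mapsto> [A w]\<close>; see \<open>proj_action_abs\<close> below. The fibres of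
  \<^const>\<open>SU\<close> under it are the cosets of the scalar matrices in \<^const>\<open>SU\<close>, so it is
  the quotient map onto the projective special unitary group, seen as a group of
  transformations.\<close>

definition proj_action :: "complex^'n^'n \<Rightarrow> 'n cproj \<Rightarrow> 'n cproj" where
  "proj_action A p = abs_cproj (A *v rep_cproj p)"

lemma proj_action_abs:
  assumes "A \<in> SU" "w \<noteq> 0"
  shows "proj_action A (abs_cproj w) = abs_cproj (A *v w)"
proof -
  have "adjoint_mat A ** A = mat 1"
    using assms(1) by (simp add: SU_def matrix_left_right_inverse)
  then have nz: "A *v v \<noteq> 0" if "v \<noteq> 0" for v
    using that by (metis matrix_vector_mul_assoc matrix_vector_mul_lid matrix_vector_mult_0_right)
  let ?v = "rep_cproj (abs_cproj w)"
  obtain c where "w = c *s ?v"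
    using abs_cproj_eq_iff[OF rep_cproj_nonzero assms(2)] abs_rep_cproj by metis
  then have "A *v w = c *s (A *v ?v)" by (metis vector_scalar_commute)
  then show ?thesis
    unfolding proj_action_def
    using abs_cproj_eq_iff nz rep_cproj_nonzero assms(2) by metis
qed

definition diagonal_torus :: "('n::finite cproj \<Rightarrow> 'n cproj) set" where
  "diagonal_torus = proj_action ` diagonal_SU"

end

theory Submission imports Defs
begin

text \<open>Every element of the identity component is the action of a unitary matrix: an isometry is
  determined up to a unitary matrix by what it does to the points \<open>[e_i + \<i> e_j]\<close>, where only the
  choice of complex conjugation remains, and the Bargmann invariant \<open>tr (P Q R)\<close> of three rank-one
  projections detects that choice continuously. Conversely, unitary matrices are joined to the
  identity inside conjugates of the diagonal torus.

  If \<open>H\<close> is connected and Abelian, the commutator of lifts of \<open>h, k \<in> H\<close> is a scalar root of unity,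
  which by connectedness is \<open>1\<close>. So the lifts of \<open>H\<close> are commuting unitary matrices, hence
  simultaneously diagonalizable, and \<open>H\<close> is conjugate into the diagonal torus. Conversely, the lifts
  of a connected Abelian group containing the torus commute with all diagonal matrices and are
  therefore diagonal.\<close>

section \<open>Unitary matrices and their action\<close>

text \<open>No Lie theory enters. What is drawn from the connectedness of \<open>Iso0\<close> and of
  \<open>H\<close> is that a continuous function with finitely many values is constant on them. The
  obstacle is that points and isometries come without continuous lifts to vectors and matrices, so a
  quantity meant to vary continuously must be expressed through the points themselves. The rank-one
  projection of a point makes this possible: the Bargmann invariant and the eigenvalue attached to a
  point are polynomials in the entries of such projections, and evaluation at a point is continuous
  for the compact-open topology.\<close>

lemma cinner_sum_left: "cinner (\<Sum>k\<in>S. f k) w = (\<Sum>k\<in>S. cinner (f k) w)"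
proof -
  have "cinner 0 w = 0" by (simp add: cinner_def)
  then show ?thesis
    by (induction S rule: infinite_finite_induct) (auto simp: cinner_add_left)
qed

lemma cinner_axis_right [simp]: "cinner v (axis i 1) = v $ i"
  by (simp add: cinner_def axis_def if_distrib cong: if_cong)

lemma cinner_adjoint: "cinner (A *v x) y = cinner x (adjoint_mat A *v y)"
proof -
  have "cinner (A *v x) y = (\<Sum>i\<in>UNIV. \<Sum>j\<in>UNIV. A $ i $ j * x $ j * cnj (y $ i))"
    by (simp add: cinner_def matrix_vector_mult_def sum_distrib_right)
  also have "\<dots> = (\<Sum>j\<in>UNIV. \<Sum>i\<in>UNIV. A $ i $ j * x $ j * cnj (y $ i))"
    by (rule sum.swap)
  also have "\<dots> = cinner x (adjoint_mat A *v y)"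
    by (simp add: cinner_def matrix_vector_mult_def adjoint_mat_def sum_distrib_left mult_ac)
  finally show ?thesis .
qed

lemma adjoint_mat_involutive [simp]: "adjoint_mat (adjoint_mat A) = A"
  by (simp add: adjoint_mat_def vec_eq_iff)

lemma adjoint_mult: "adjoint_mat (A ** B) = adjoint_mat B ** adjoint_mat A"
  by (simp add: adjoint_mat_def matrix_matrix_mult_def vec_eq_iff mult.commute)

text \<open>The full unitary group replaces \<open>SU\<close> as the source of lifts, so that
  representatives may be multiplied by any unit scalar without correcting a determinant. The
  transition back to determinant one takes place in \<open>diagonal_torus_eq\<close>.\<close>

definition unitary :: "(complex^'n^'n) set" where
  "unitary = {A. A ** adjoint_mat A = mat 1}"

lemma unitaryD:
  assumes "A \<in> unitary"
  shows "A ** adjoint_mat A = mat 1" "adjoint_mat A ** A = mat 1"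
  using assms by (auto simp: unitary_def matrix_left_right_inverse)

lemma unitary_mult: "A \<in> unitary \<Longrightarrow> B \<in> unitary \<Longrightarrow> A ** B \<in> unitary"
proof -
  assume "A \<in> unitary" "B \<in> unitary"
  then have "A ** (B ** adjoint_mat B) ** adjoint_mat A = mat 1"
    by (simp add: unitaryD)
  then show ?thesis by (simp add: unitary_def adjoint_mult matrix_mul_assoc)
qed

lemma unitary_adjoint: "A \<in> unitary \<Longrightarrow> adjoint_mat A \<in> unitary"
  using unitaryD by (force simp: unitary_def)

lemma adjoint_mat_scalar: "adjoint_mat (mat c) = mat (cnj c)"
  by (simp add: adjoint_mat_def mat_def vec_eq_iff)

lemma mat_mult_component: "(mat c ** A) $ i $ j = (c :: 'a::semiring_1) * A $ i $ j"
  by (simp add: matrix_matrix_mult_def mat_def if_distrib[of "\<lambda>x. x * _"] cong: if_cong)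

lemma mat_mult_mat: "mat c ** mat d = (mat (c * d) :: 'a::semiring_1^'n^'n)"
  by (simp add: vec_eq_iff mat_mult_component) (simp add: mat_def)

lemma mat_mult_commute: "mat c ** A = A ** mat (c :: 'a::comm_semiring_1)"
  by (simp add: matrix_matrix_mult_def mat_def vec_eq_iff mult.commute if_distrib if_distribR cong: if_cong)

lemma mat_vec: "mat c *v x = c *s (x :: 'a::semiring_1^'n)"
  by (simp add: matrix_vector_mult_def mat_def vec_eq_iff if_distrib if_distribR cong: if_cong)

lemma det_mat_scalar: "det (mat c :: 'a::comm_ring_1^'n^'n) = c ^ CARD('n)"
  by (subst det_diagonal) (auto simp: mat_def)

lemma unitary_mat: "cmod c = 1 \<Longrightarrow> mat c \<in> unitary"
  by (simp add: unitary_def adjoint_mat_scalar mat_mult_mat complex_norm_square[symmetric])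

lemma unitary_1 [simp]: "mat 1 \<in> unitary"
  by (simp add: unitary_mat)

lemma unitary_cinner: "A \<in> unitary \<Longrightarrow> cinner (A *v x) (A *v y) = cinner x y"
  by (simp add: cinner_adjoint matrix_vector_mul_assoc unitaryD)

lemma unitary_norm: "A \<in> unitary \<Longrightarrow> norm (A *v x) = norm x"
proof -
  assume "A \<in> unitary"
  then have "complex_of_real ((norm (A *v x))\<^sup>2) = complex_of_real ((norm x)\<^sup>2)"
    by (simp only: cinner_self[symmetric] unitary_cinner)
  then show ?thesis
    by (simp only: of_real_eq_iff) simp
qed

lemma unitary_nonzero: "A \<in> unitary \<Longrightarrow> x \<noteq> 0 \<Longrightarrow> A *v x \<noteq> 0"
  by (metis unitary_norm norm_eq_zero)

lemma matrix_vector_mult_axis: "(A *v axis j 1) $ i = (A :: 'a::semiring_1^'n^'m) $ i $ j"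
  by (simp add: matrix_vector_mult_def axis_def if_distrib cong: if_cong)

lemma unitary_iff_columns:
  "A \<in> unitary \<longleftrightarrow> (\<forall>i j. cinner (A *v axis i 1) (A *v axis j 1) = (if i = j then 1 else 0))"
proof -
  have "A \<in> unitary \<longleftrightarrow> adjoint_mat A ** A = mat 1"
    by (simp add: unitary_def matrix_left_right_inverse)
  also have "\<dots> \<longleftrightarrow> (\<forall>i j. (adjoint_mat A ** A) $ j $ i = (if i = j then 1 else 0))"
    by (auto simp: vec_eq_iff mat_def)
  also have "\<dots> \<longleftrightarrow> (\<forall>i j. cinner (A *v axis i 1) (A *v axis j 1) = (if i = j then 1 else 0))"
    by (simp add: cinner_def matrix_matrix_mult_def adjoint_mat_def mult.commute
        matrix_vector_mult_axis)
  finally show ?thesis .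
qed

section \<open>Points of projective space and the unitary action on them\<close>

lemma abs_cproj_surj:
  assumes "r > 0" obtains v where "norm v = r" "v \<noteq> 0" "p = abs_cproj v"
proof -
  let ?v = "rep_cproj p"
  let ?u = "complex_of_real (r / norm ?v) *s ?v"
  have nz: "?v \<noteq> 0" by (rule rep_cproj_nonzero)
  have n1: "norm ?u = r" using nz assms by (simp add: norm_scale_vec norm_divide)
  then have 0: "?u \<noteq> 0" using assms by force
  then have "abs_cproj ?v = abs_cproj ?u" using nz abs_cproj_eq_iff by blast
  with n1 0 show ?thesis using that by (metis abs_rep_cproj)
qed

lemma abs_cproj_scale: "c \<noteq> 0 \<Longrightarrow> v \<noteq> 0 \<Longrightarrow> abs_cproj (c *s v) = abs_cproj v"
  using abs_cproj_eq_iff[of v "c *s v"] by (auto simp: vector_mul_eq_0)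

lemma proj_action_unitary:
  assumes "A \<in> unitary" "w \<noteq> 0"
  shows "proj_action A (abs_cproj w) = abs_cproj (A *v w)"
proof -
  let ?v = "rep_cproj (abs_cproj w)"
  obtain c where "w = c *s ?v"
    using abs_cproj_eq_iff[OF rep_cproj_nonzero assms(2)] abs_rep_cproj by metis
  then have "A *v w = c *s (A *v ?v)" by (metis vector_scalar_commute)
  then show ?thesis
    unfolding proj_action_def
    using abs_cproj_eq_iff unitary_nonzero[OF assms(1)] rep_cproj_nonzero assms(2) by metis
qed

lemma proj_action_mult:
  assumes "A \<in> unitary" "B \<in> unitary"
  shows "proj_action (A ** B) = proj_action A \<circ> proj_action B"
proof
  fix p :: "'a cproj"
  obtain v where "v \<noteq> 0" "p = abs_cproj v" using abs_cproj_surj[of 1] by auto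
  then show "proj_action (A ** B) p = (proj_action A \<circ> proj_action B) p"
    using assms by (simp add: proj_action_unitary unitary_mult unitary_nonzero matrix_vector_mul_assoc)
qed

lemma proj_action_mat:
  assumes "cmod c = 1" shows "proj_action (mat c) = id"
proof
  fix p :: "'a cproj"
  obtain v where "v \<noteq> 0" "p = abs_cproj v" using abs_cproj_surj[of 1] by auto
  moreover have "c \<noteq> 0" using assms by auto
  ultimately show "proj_action (mat c) p = id p"
    using assms by (simp add: proj_action_unitary unitary_mat mat_vec abs_cproj_scale)
qed

lemma proj_action_scale:
  assumes "cmod c = 1" "A \<in> unitary" shows "proj_action (mat c ** A) = proj_action A"
  using assms by (simp add: proj_action_mult unitary_mat proj_action_mat)

lemma proj_action_adjoint:
  assumes "A \<in> unitary"
  shows "proj_action A \<circ> proj_action (adjoint_mat A) = id"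
    "proj_action (adjoint_mat A) \<circ> proj_action A = id"
  using assms by (simp_all add: proj_action_mult[symmetric] unitary_adjoint unitaryD proj_action_mat)

lemma proj_action_isometry:
  assumes "A \<in> unitary" shows "proj_action A \<in> isometries"
proof -
  have "dist (proj_action A p) (proj_action A q) = dist p q" for p q
  proof -
    obtain v where v: "v \<noteq> 0" "p = abs_cproj v" using abs_cproj_surj[of 1] by auto
    obtain w where w: "w \<noteq> 0" "q = abs_cproj w" using abs_cproj_surj[of 1] by auto
    show ?thesis using v w assms
      by (simp add: proj_action_unitary dist_abs_cproj unitary_nonzero unitary_cinner unitary_norm)
  qed
  moreover have "bij (proj_action A)"
    using proj_action_adjoint[OF assms] by (intro o_bij)
  ultimately show ?thesis by (simp add: isometries_def)
qed

lemma isometries_comp: "f \<in> isometries \<Longrightarrow> g \<in> isometries \<Longrightarrow> f \<circ> g \<in> isometries"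
  by (auto simp: isometries_def bij_comp)

text \<open>Since \<open>arccos\<close> is injective on \<open>[0, 1]\<close>, equal distances mean
  equal normalized ratios; representatives of unchanged norm turn this into equal moduli. All
  information about an abstract isometry enters through this lemma.\<close>

lemma isometry_cmod_cinner:
  assumes "f \<in> isometries" "v \<noteq> 0" "w \<noteq> 0"
    and "f (abs_cproj v) = abs_cproj v'" "f (abs_cproj w) = abs_cproj w'"
    and n: "norm v' = norm v" "norm w' = norm w"
  shows "cmod (cinner v' w') = cmod (cinner v w)"
proof -
  have nz: "v' \<noteq> 0" "w' \<noteq> 0" using assms by auto
  have "dist (abs_cproj v') (abs_cproj w') = dist (abs_cproj v) (abs_cproj w)"
    using assms(1,4,5) by (metis (mono_tags, lifting) isometries_def mem_Collect_eq)
  then have "cmod (cinner v' w') / (norm v' * norm w') = cmod (cinner v w) / (norm v * norm w)"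
    using nz assms(2,3) fs_ratio_bounds
    by (metis abs_of_nonneg arccos_eq_iff dist_abs_cproj)
  then show ?thesis using assms(2,3) n by auto
qed

text \<open>Every nonzero vector is an eigenvector: the coordinate vectors make \<open>A\<close>
  diagonal, and the all-ones vector forces the diagonal entries to agree.\<close>

lemma proj_action_fixes_imp_scalar:
  assumes A: "A \<in> unitary" and "proj_action A = id"
  obtains c where "cmod c = 1" "A = mat c"
proof -
  have ev: "\<exists>c. A *v v = c *s v" if "v \<noteq> 0" for v
    using that abs_cproj_eq_iff[OF that unitary_nonzero[OF A that]]
      proj_action_unitary[OF A that] assms(2) by auto
  have "\<forall>i. \<exists>c. A *v axis i 1 = c *s axis i 1"
    by (intro allI ev) (simp add: axis_eq_0_iff)
  then obtain d where "\<forall>i. A *v axis i 1 = d i *s axis i 1" by metis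
  then have "(A *v axis j 1) $ i = (d j *s axis j 1) $ i" for i j by simp
  then have d: "A $ i $ j = (if i = j then d j else 0)" for i j
    unfolding matrix_vector_mult_axis by (simp add: axis_def)
  have "(1 :: complex^'a) \<noteq> 0" by (simp add: vec_eq_iff)
  then obtain c where "A *v 1 = c *s 1" using ev by blast
  then have c: "d i = c" for i
    by (simp add: vec_eq_iff matrix_vector_mult_def d if_distribR cong: if_cong)
  have "A = mat c" by (simp add: vec_eq_iff mat_def d c)
  moreover have "cmod c = 1"
    using unitary_norm[OF A, of 1] \<open>A = mat c\<close> \<open>(1 :: complex^'a) \<noteq> 0\<close>
    by (simp add: mat_vec norm_scale_vec)
  ultimately show ?thesis using that by blast
qed

lemma proj_action_eq_imp_scalar:
  assumes A: "A \<in> unitary" and B: "B \<in> unitary" and "proj_action A = proj_action B"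
  obtains c where "cmod c = 1" "A = mat c ** B"
proof -
  have "proj_action (A ** adjoint_mat B) = id"
    using assms by (simp add: proj_action_mult unitary_adjoint proj_action_adjoint)
  then obtain c where c: "cmod c = 1" "A ** adjoint_mat B = mat c"
    using proj_action_fixes_imp_scalar A B unitary_mult unitary_adjoint by metis
  then have "A = mat c ** B"
    by (metis B matrix_mul_assoc matrix_mul_rid unitaryD(2))
  with c show ?thesis using that by blast
qed

section \<open>Simultaneous diagonalization\<close>

text \<open>Bridges complex and real subspaces: closedness, and hence compactness of the unit sphere
  in \<open>W\<close>, is available for real ones.\<close>

lemma vec_subspace_imp_subspace:
  assumes "vec.subspace (W :: (complex^'n) set)" shows "subspace W"
proof -
  have "r *\<^sub>R x = complex_of_real r *s x" for r and x :: "complex^'n"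
    by (simp add: vec_eq_iff) (simp add: scaleR_conv_of_real)
  then show ?thesis
    using assms by (simp add: subspace_def vec.subspace_def)
qed

lemma continuous_on_cinner [continuous_intros]:
  "continuous_on S f \<Longrightarrow> continuous_on S g \<Longrightarrow> continuous_on S (\<lambda>x. cinner (f x) (g x))"
  unfolding cinner_def by (intro continuous_intros)

lemma continuous_on_matrix_vector [continuous_intros]:
  "continuous_on S f \<Longrightarrow> continuous_on S (\<lambda>x. (A :: complex^'n^'m) *v f x)"
  unfolding matrix_vector_mult_def by (intro continuous_intros)

text \<open>Variational proof: the quadratic form \<open>q\<close> attains its maximum
  \<open>M\<close> on the unit sphere of \<open>W\<close>, and a maximizer is an eigenvector for
  \<open>M\<close>.\<close>

lemma hermitian_eigenvector:
  assumes K: "adjoint_mat K = K" and W: "vec.subspace W" and inv: "\<And>w. w \<in> W \<Longrightarrow> K *v w \<in> W"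
    and nz: "w0 \<in> W" "w0 \<noteq> 0"
  obtains u c where "u \<in> W" "u \<noteq> 0" "K *v u = c *s u"
proof -
  define S where "S = W \<inter> sphere 0 1"
  define q where "q w = Re (cinner (K *v w) w)" for w
  have smul: "a *s w \<in> W" if "w \<in> W" for a w
    using W that by (simp add: vec.subspace_def)
  have rmul: "complex_of_real (1 / norm w) *s w \<in> S" if "w \<in> W" "w \<noteq> 0" for w
    using smul that by (simp add: S_def norm_scale_vec norm_divide)
  have "compact S"
    unfolding S_def by (intro closed_Int_compact closed_subspace vec_subspace_imp_subspace W) simp
  moreover have "S \<noteq> {}" using rmul nz by blast
  moreover have "continuous_on S q" unfolding q_def by (intro continuous_intros)
  ultimately obtain u where u: "u \<in> S" and max: "\<And>w. w \<in> S \<Longrightarrow> q w \<le> q u"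
    using continuous_attains_sup by metis
  define M where "M = q u"
  have uW: "u \<in> W" and nu: "norm u = 1" using u by (auto simp: S_def)
  have le: "q w \<le> M * (norm w)\<^sup>2" if "w \<in> W" for w
  proof (cases "w = 0")
    case False
    let ?r = "complex_of_real (1 / norm w)"
    have "q (?r *s w) = (1 / norm w)\<^sup>2 * q w"
      by (simp add: q_def vector_scalar_commute cinner_scale_left cinner_scale_right
          power2_eq_square del: of_real_divide flip: of_real_mult)
    then have "(1 / norm w)\<^sup>2 * q w \<le> M" using max[OF rmul[OF that False]] by (simp add: M_def)
    then show ?thesis using False by (simp add: field_simps power2_eq_square)
  qed (simp add: q_def cinner_def)
  \<comment> \<open>The vector \<open>-2 w\<close> is the gradient at \<open>u\<close> of
    \<open>q v - M * (norm v)^2\<close>, a function that is at most 0 on \<open>W\<close> and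
    vanishes at \<open>u\<close>. Moving from \<open>u\<close> by \<open>- t w\<close> stays in
    \<open>W\<close> and yields the quadratic inequality in \<open>t\<close> that follows.\<close>
  define w where "w = complex_of_real M *s u - K *v u"
  have wW: "w \<in> W"
    unfolding w_def using W by (intro vec.subspace_diff smul inv uW)
  have "2 * t * (norm w)\<^sup>2 \<le> t\<^sup>2 * (M * (norm w)\<^sup>2 - q w)" for t
  proof -
    let ?v = "u - complex_of_real t *s w"
    have Kuw: "cinner (K *v w) u = cnj (cinner (K *v u) w)"
      by (metis K cinner_adjoint cinner_commute)
    have re: "Re (cinner w u) = Re (cinner u w)"
      by (subst cinner_commute) simp
    have nv: "(norm v)\<^sup>2 = Re (cinner v v)" for v :: "complex^'a"
      by (simp add: cinner_self)
    have "q ?v = q u - 2 * t * Re (cinner (K *v u) w) + t\<^sup>2 * q w"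
      by (simp add: q_def matrix_vector_mult_diff_distrib vector_scalar_commute cinner_diff_left
          cinner_diff_right cinner_scale_left cinner_scale_right Kuw power2_eq_square algebra_simps)
    moreover have "(norm ?v)\<^sup>2 = 1 - 2 * t * Re (cinner u w) + t\<^sup>2 * (norm w)\<^sup>2"
      unfolding nv using nv[of u] nu re
      by (simp add: cinner_diff_left
          cinner_diff_right cinner_scale_left cinner_scale_right power2_eq_square algebra_simps)
    moreover have "q ?v \<le> M * (norm ?v)\<^sup>2"
      using W by (intro le vec.subspace_diff smul wW uW)
    moreover have "(norm w)\<^sup>2 = M * Re (cinner u w) - Re (cinner (K *v u) w)"
      unfolding nv by (subst w_def) (simp add: cinner_diff_left cinner_scale_left)
    ultimately have "M - 2 * t * Re (cinner (K *v u) w) + t\<^sup>2 * q w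
        \<le> M * (1 - 2 * t * Re (cinner u w) + t\<^sup>2 * (norm w)\<^sup>2)"
      and "2 * t * (norm w)\<^sup>2 = 2 * t * (M * Re (cinner u w) - Re (cinner (K *v u) w))"
      by (simp_all only: M_def)
    then show ?thesis
      by (simp add: algebra_simps)
  qed note quad = this
  have "w = 0"
  proof (rule ccontr)
    assume "w \<noteq> 0"
    define a where "a = (norm w)\<^sup>2"
    \<comment> \<open>The inequality is tested at \<open>t = a / b\<close>: as \<open>b\<close>
      exceeds the quadratic coefficient, the right side is at most \<open>a^2 / b\<close>, half of
      the left side. The \<open>+ 1\<close> keeps \<open>b\<close> positive.\<close>
    define b where "b = \<bar>M * a - q w\<bar> + 1"
    have a: "a > 0" using \<open>w \<noteq> 0\<close> by (simp add: a_def)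
    have b: "b > 0" "M * a - q w < b" by (auto simp: b_def)
    have "2 * (a / b) * a \<le> (a / b)\<^sup>2 * (M * a - q w)" using quad[of "a / b"] unfolding a_def .
    also have "\<dots> \<le> (a / b)\<^sup>2 * b" using b by (intro mult_left_mono) auto
    also have "\<dots> = (a / b) * a" using b by (simp add: power2_eq_square)
    finally have "2 * (a / b) * a \<le> (a / b) * a" .
    moreover have "(a / b) * a > 0" using a b by simp
    ultimately show False by linarith
  qed
  then have "K *v u = complex_of_real M *s u" by (simp add: w_def)
  with uW nu show ?thesis using that[of u] by force
qed

text \<open>In a nonzero invariant subspace \<open>V\<close> of least dimension, an eigenspace of
  one \<open>K\<close> is nonzero and, by commutation, invariant under the whole family. Minimality
  makes it all of \<open>V\<close>, so each nonzero vector of \<open>V\<close> is a common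
  eigenvector, however large the family is.\<close>

lemma commuting_hermitian_common_eigenvector:
  assumes herm: "\<And>K. K \<in> \<K> \<Longrightarrow> adjoint_mat K = K"
    and comm: "\<And>K L. K \<in> \<K> \<Longrightarrow> L \<in> \<K> \<Longrightarrow> K ** L = L ** K"
    and W: "vec.subspace W" and inv: "\<And>K w. K \<in> \<K> \<Longrightarrow> w \<in> W \<Longrightarrow> K *v w \<in> W"
    and nz: "w0 \<in> W" "w0 \<noteq> 0"
  obtains u where "u \<in> W" "u \<noteq> 0" "\<And>K. K \<in> \<K> \<Longrightarrow> \<exists>c. K *v u = c *s u"
proof -
  define P where "P V \<longleftrightarrow> V \<subseteq> W \<and> vec.subspace V \<and> (\<forall>K\<in>\<K>. \<forall>w\<in>V. K *v w \<in> V) \<and> (\<exists>v\<in>V. v \<noteq> 0)"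
    for V
  have "P W" using assms by (auto simp: P_def)
  then obtain V where V: "P V" and least: "\<And>V'. P V' \<Longrightarrow> vec.dim V \<le> vec.dim V'"
    using ex_has_least_nat[of P W vec.dim] by blast
  obtain v where v: "v \<in> V" "v \<noteq> 0" using V by (auto simp: P_def)
  have Vs: "vec.subspace V" using V by (simp add: P_def)
  show ?thesis
  proof (rule that)
    show "v \<in> W" "v \<noteq> 0" using V v by (auto simp: P_def)
    fix K assume K: "K \<in> \<K>"
    have "\<And>w. w \<in> V \<Longrightarrow> K *v w \<in> V" using V K by (simp add: P_def)
    then obtain u c where u: "u \<in> V" "u \<noteq> 0" "K *v u = c *s u"
      using hermitian_eigenvector[OF herm[OF K] Vs _ v] by metis
    define E where "E = {w \<in> V. K *v w = c *s w}"
    have "L *v w \<in> E" if "L \<in> \<K>" "w \<in> E" for L w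
    proof -
      have "K *v (L *v w) = c *s (L *v w)"
        using that comm[OF K \<open>L \<in> \<K>\<close>]
        by (metis (mono_tags, lifting) E_def matrix_vector_mul_assoc mem_Collect_eq vector_scalar_commute)
      then show ?thesis using that V by (simp add: E_def P_def)
    qed
    moreover have Es: "vec.subspace E"
      using Vs by (auto simp: E_def vec.subspace_def matrix_vector_right_distrib
          vector_scalar_commute vector_add_ldistrib mult.commute)
    ultimately have "P E" using u V by (auto simp: P_def E_def)
    then have "E = V"
      using least Es Vs by (intro vec.subspace_dim_equal) (auto simp: E_def)
    then show "\<exists>c. K *v v = c *s v" using v by (auto simp: E_def)
  qed
qed

definition orthonormal_on :: "'i set \<Rightarrow> ('i \<Rightarrow> complex^'n) \<Rightarrow> bool" where
  "orthonormal_on I g \<longleftrightarrow> (\<forall>i\<in>I. \<forall>j\<in>I. cinner (g i) (g j) = (if i = j then 1 else 0))"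

text \<open>Fewer than \<open>CARD('n)\<close> vectors cannot span; a vector outside their span
  minus its orthogonal projection onto the span is nonzero and orthogonal to them.\<close>

lemma exists_orthogonal:
  fixes g :: "'i \<Rightarrow> complex^'n"
  assumes "orthonormal_on I g" "finite I" "card I < CARD('n)"
  shows "\<exists>w. w \<noteq> 0 \<and> (\<forall>k\<in>I. cinner w (g k) = 0)"
proof -
  have "vec.dim (vec.span (g ` I)) \<le> card (g ` I)"
    using assms by (intro vec.dim_le_card) auto
  also have "\<dots> < CARD('n)"
    using assms card_image_le[of I g] by linarith
  finally have "vec.span (g ` I) \<noteq> UNIV"
    by (metis less_irrefl vec_dim_card)
  then obtain v where v: "v \<notin> vec.span (g ` I)" by blast
  define s where "s = (\<Sum>k\<in>I. cinner v (g k) *s g k)"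
  have "s \<in> vec.span (g ` I)"
    unfolding s_def by (intro vec.span_sum vec.span_scale vec.span_base) auto
  then have "v - s \<noteq> 0" using v by auto
  moreover have "cinner (v - s) (g k) = 0" if "k \<in> I" for k
  proof -
    have "cinner s (g k) = (\<Sum>j\<in>I. cinner v (g j) * (if j = k then 1 else 0))"
      unfolding s_def cinner_sum_left using assms(1) that
      by (intro sum.cong) (auto simp: cinner_scale_left orthonormal_on_def)
    also have "\<dots> = cinner v (g k)" using assms(2) that by (simp add: if_distrib cong: if_cong)
    finally show ?thesis by (simp add: cinner_diff_left)
  qed
  ultimately show ?thesis by blast
qed

lemma commuting_hermitian_eigenbasis:
  fixes \<K> :: "(complex^'n^'n) set"
  assumes herm: "\<And>K. K \<in> \<K> \<Longrightarrow> adjoint_mat K = K"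
    and comm: "\<And>K L. K \<in> \<K> \<Longrightarrow> L \<in> \<K> \<Longrightarrow> K ** L = L ** K"
  obtains g :: "'n \<Rightarrow> complex^'n"
  where "orthonormal_on UNIV g" "\<And>K i. K \<in> \<K> \<Longrightarrow> \<exists>c. K *v g i = c *s g i"
proof -
  have "\<exists>g :: 'n \<Rightarrow> complex^'n. orthonormal_on I g \<and> (\<forall>K\<in>\<K>. \<forall>i\<in>I. \<exists>c. K *v g i = c *s g i)"
    if "finite I" for I
    using that
  proof (induction I)
    case (insert i I)
    then obtain g :: "'n \<Rightarrow> complex^'n" where g: "orthonormal_on I g"
      and ev: "\<And>K k. K \<in> \<K> \<Longrightarrow> k \<in> I \<Longrightarrow> \<exists>c. K *v g k = c *s g k" by blast
    \<comment> \<open>The orthogonal complement of the eigenvectors found so far is invariant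
      because each \<open>K\<close> is self-adjoint, so the next common eigenvector can be sought
      inside it.\<close>
    define W where "W = {w. \<forall>k\<in>I. cinner w (g k) = 0}"
    have cI: "card I < CARD('n)"
      using insert by (intro psubset_card_mono) auto
    obtain w where w: "w \<in> W" "w \<noteq> 0"
      using exists_orthogonal[OF g \<open>finite I\<close> cI] by (auto simp: W_def)
    have Ws: "vec.subspace W"
      by (auto simp: vec.subspace_def W_def cinner_add_left cinner_scale_left)
        (simp add: cinner_def)
    have Wi: "K *v w \<in> W" if K: "K \<in> \<K>" "w \<in> W" for K w
    proof -
      have "cinner (K *v w) (g k) = 0" if k: "k \<in> I" for k
      proof -
        obtain c where "K *v g k = c *s g k" using ev K k by blast
        then show ?thesis using K(2) k
          by (simp add: cinner_adjoint herm[OF K(1)] cinner_scale_right W_def)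
      qed
      then show ?thesis by (simp add: W_def)
    qed
    obtain u where u: "u \<in> W" "u \<noteq> 0" "\<And>K. K \<in> \<K> \<Longrightarrow> \<exists>c. K *v u = c *s u"
      using commuting_hermitian_common_eigenvector[of \<K>, OF herm comm Ws Wi w] by metis
    define v where "v = complex_of_real (1 / norm u) *s u"
    have vv: "cinner v v = 1"
      using u(2) by (simp add: cinner_self) (simp add: v_def norm_scale_vec norm_divide)
    have vW: "cinner v (g k) = 0" "cinner (g k) v = 0" if "k \<in> I" for k
      using u(1) that cinner_commute[of v "g k"] cinner_commute[of "g k" u]
      by (auto simp: v_def W_def cinner_scale_left cinner_scale_right)
    have vev: "\<exists>c. K *v v = c *s v" if "K \<in> \<K>" for K
      using u(3)[OF that] by (auto simp: v_def vector_scalar_commute mult.commute)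
    have "orthonormal_on (insert i I) (g(i := v))"
      using g vW vv \<open>i \<notin> I\<close> by (auto simp: orthonormal_on_def)
    moreover have "\<forall>K\<in>\<K>. \<forall>k\<in>insert i I. \<exists>c. K *v (g(i := v)) k = c *s (g(i := v)) k"
      using ev vev by auto
    ultimately show ?case by blast
  qed (simp add: orthonormal_on_def)
  from this[of UNIV] show ?thesis using that by auto
qed

lemma matrix_mult_distribs:
  fixes A :: "'a::ring_1^'n^'m"
  shows "A ** (B - C) = A ** B - A ** C" "(A + A') ** B = A ** B + A' ** B"
    "(A - A') ** B = A ** B - A' ** B"
  by (simp_all add: vec_eq_iff matrix_matrix_mult_def algebra_simps sum.distrib sum_subtractf)

text \<open>Reduction to the Hermitian case: \<open>h1 A\<close> and \<open>h2 A\<close> are twice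
  the real part and minus twice the imaginary part of \<open>A\<close>, and
  \<open>h1 A - \<i> h2 A = 2 A\<close> recovers the eigenvalues of \<open>A\<close>.\<close>

lemma commuting_unitary_eigenbasis:
  fixes \<A> :: "(complex^'n^'n) set"
  assumes un: "\<A> \<subseteq> unitary"
    and comm: "\<And>A B. A \<in> \<A> \<Longrightarrow> B \<in> \<A> \<Longrightarrow> A ** B = B ** A"
  obtains g :: "'n \<Rightarrow> complex^'n"
  where "orthonormal_on UNIV g" "\<And>A i. A \<in> \<A> \<Longrightarrow> \<exists>c. A *v g i = c *s g i"
proof -
  define \<B> where "\<B> = \<A> \<union> adjoint_mat ` \<A>"
  \<comment> \<open>The adjoint of \<open>B\<close> is its inverse, and whatever commutes with
    \<open>B\<close> commutes with its inverse.\<close>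
  have ca: "A ** adjoint_mat B = adjoint_mat B ** A" if "A \<in> \<A>" "B \<in> \<A>" for A B
  proof -
    have B: "B \<in> unitary" using un that by blast
    have "adjoint_mat B ** A = adjoint_mat B ** A ** (B ** adjoint_mat B)"
      by (simp add: unitaryD[OF B])
    also have "\<dots> = adjoint_mat B ** (A ** B) ** adjoint_mat B"
      by (simp only: matrix_mul_assoc)
    also have "\<dots> = (adjoint_mat B ** B) ** A ** adjoint_mat B"
      by (simp only: comm[OF that] matrix_mul_assoc)
    finally show ?thesis by (simp add: unitaryD[OF B])
  qed
  have cB: "A ** B = B ** A" if "A \<in> \<B>" "B \<in> \<B>" for A B
    using that comm ca unfolding \<B>_def by (auto simp: adjoint_mult[symmetric])
  define h1 where "h1 A = A + adjoint_mat A" for A :: "complex^'n^'n"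
  define h2 where "h2 A = mat \<i> ** (A - adjoint_mat A)" for A :: "complex^'n^'n"
  have cadd: "A ** (B + C) = (B + C) ** A" "A ** (B - C) = (B - C) ** A"
    "A ** (mat \<i> ** B) = (mat \<i> ** B) ** A"
    if "A ** B = B ** A" "A ** C = C ** A" for A B C :: "complex^'n^'n"
  proof -
    show "A ** (B + C) = (B + C) ** A" "A ** (B - C) = (B - C) ** A"
      using that by (simp_all add: matrix_add_ldistrib matrix_mult_distribs)
    have "A ** (mat \<i> ** B) = mat \<i> ** (A ** B)"
      by (simp only: matrix_mul_assoc mat_mult_commute[of \<i> A])
    then show "A ** (mat \<i> ** B) = (mat \<i> ** B) ** A"
      using that by (simp only: matrix_mul_assoc)
  qed
  have hc: "A ** h B = h B ** A" if "A \<in> \<B>" "B \<in> \<A>" "h = h1 \<or> h = h2" for A B h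
  proof -
    have "A ** B = B ** A" "A ** adjoint_mat B = adjoint_mat B ** A"
      using that by (auto intro!: cB simp: \<B>_def)
    then show ?thesis using that(3) cadd by (auto simp: h1_def h2_def)
  qed
  define \<K> where "\<K> = h1 ` \<A> \<union> h2 ` \<A>"
  have "adjoint_mat K = K" if "K \<in> \<K>" for K
    using that by (auto simp: \<K>_def h1_def h2_def vec_eq_iff adjoint_mat_def mat_mult_component algebra_simps)
  moreover have "K ** L = L ** K" if KL: "K \<in> \<K>" "L \<in> \<K>" for K L
  proof -
    obtain A where A: "A \<in> \<A>" "K = h1 A \<or> K = h2 A" using KL(1) unfolding \<K>_def by blast
    obtain B where B: "B \<in> \<A>" "L = h1 B \<or> L = h2 B" using KL(2) unfolding \<K>_def by blast
    have "L ** C = C ** L" if "C \<in> \<B>" for C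
      using B(2) hc[OF that B(1), of h1] hc[OF that B(1), of h2] by auto
    then have "L ** A = A ** L" "L ** adjoint_mat A = adjoint_mat A ** L"
      using A(1) by (auto simp: \<B>_def)
    then show ?thesis using A(2) cadd by (auto simp: h1_def h2_def)
  qed
  ultimately obtain g :: "'n \<Rightarrow> complex^'n" where g: "orthonormal_on UNIV g"
    and ev: "\<And>K i. K \<in> \<K> \<Longrightarrow> \<exists>c. K *v g i = c *s g i"
    using commuting_hermitian_eigenbasis by blast
  have "\<exists>c. A *v g i = c *s g i" if A: "A \<in> \<A>" for A i
  proof -
    obtain c where c: "h1 A *v g i = c *s g i" using ev A unfolding \<K>_def by blast
    obtain d where d: "h2 A *v g i = d *s g i" using ev A unfolding \<K>_def by blast
    have "h1 A *v v - \<i> *s (h2 A *v v) = 2 *s (A *v v)" for v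
      by (simp add: h1_def h2_def matrix_vector_mult_add_rdistrib matrix_vector_mult_diff_rdistrib
          mat_vec flip: matrix_vector_mul_assoc) (simp add: vec_eq_iff algebra_simps)
    from this[of "g i"] have "A *v g i = ((c - \<i> * d) / 2) *s g i"
      unfolding c d by (simp add: vec_eq_iff field_simps)
    then show ?thesis by blast
  qed
  with g show ?thesis using that by blast
qed

lemma commuting_unitary_diagonal:
  fixes \<A> :: "(complex^'n^'n) set"
  assumes un: "\<A> \<subseteq> unitary"
    and comm: "\<And>A B. A \<in> \<A> \<Longrightarrow> B \<in> \<A> \<Longrightarrow> A ** B = B ** A"
  obtains G where "G \<in> unitary" "\<And>A i j. A \<in> \<A> \<Longrightarrow> i \<noteq> j \<Longrightarrow> (adjoint_mat G ** A ** G) $ i $ j = 0"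
proof -
  obtain g :: "'n \<Rightarrow> complex^'n" where g: "orthonormal_on UNIV g"
    and ev: "\<And>A i. A \<in> \<A> \<Longrightarrow> \<exists>c. A *v g i = c *s g i"
    using commuting_unitary_eigenbasis[OF assms] by blast
  define G :: "complex^'n^'n" where "G = (\<chi> i j. g j $ i)"
  have col: "G *v axis i 1 = g i" for i
    by (simp add: vec_eq_iff matrix_vector_mult_axis) (simp add: G_def)
  have G: "G \<in> unitary" using g by (simp add: unitary_iff_columns col orthonormal_on_def)
  have "(adjoint_mat G ** A ** G) $ i $ j = 0" if A: "A \<in> \<A>" and "i \<noteq> j" for A i j
  proof -
    obtain c where c: "A *v g j = c *s g j" using ev[OF A] by blast
    have "(adjoint_mat G ** A ** G) $ i $ j = cinner (adjoint_mat G *v (A *v (G *v axis j 1))) (axis i 1)"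
      by (simp add: matrix_vector_mul_assoc matrix_vector_mult_axis matrix_mul_assoc)
    also have "\<dots> = cinner (A *v g j) (g i)"
      by (simp only: cinner_adjoint[of "adjoint_mat G"] adjoint_mat_involutive col)
    also have "\<dots> = c * cinner (g j) (g i)"
      by (simp add: c cinner_scale_left)
    also have "\<dots> = 0" using g that by (simp add: orthonormal_on_def)
    finally show ?thesis .
  qed
  with G show ?thesis using that by blast
qed

section \<open>The compact-open topology\<close>

lemma topspace_compact_open [simp]: "topspace compact_open = UNIV"
proof -
  have "{f. f ` {} \<subseteq> UNIV} \<in> {{f :: 'a \<Rightarrow> 'b. f ` K \<subseteq> U} |K U. compact K \<and> open U}"
    by blast
  then show ?thesis
    unfolding compact_open_def topology_generated_by_topspace by auto
qed

lemma continuous_map_into_compact_open: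
  assumes "\<And>K U. compact K \<Longrightarrow> open U \<Longrightarrow> openin X {x \<in> topspace X. f x ` K \<subseteq> U}"
  shows "continuous_map X compact_open (f :: 'x \<Rightarrow> 'a::topological_space \<Rightarrow> 'b::topological_space)"
  unfolding compact_open_def
proof (rule continuous_on_generated_topo)
  fix W assume "W \<in> {{f :: 'a \<Rightarrow> 'b. f ` K \<subseteq> U} |K U. compact K \<and> open U}"
  then obtain K U where "W = {f. f ` K \<subseteq> U}" "compact K" "open U" by blast
  moreover from this have "f -` W \<inter> topspace X = {x \<in> topspace X. f x ` K \<subseteq> U}" by blast
  ultimately show "openin X (f -` W \<inter> topspace X)" using assms by simp
next
  show "f ` topspace X \<subseteq> \<Union> {{f :: 'a \<Rightarrow> 'b. f ` K \<subseteq> U} |K U. compact K \<and> open U}"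
    by (simp only: topspace_compact_open[unfolded compact_open_def topology_generated_by_topspace]
        subset_UNIV)
qed

lemma openin_compact_open: "compact K \<Longrightarrow> open U \<Longrightarrow> openin compact_open {f. f ` K \<subseteq> U}"
  unfolding compact_open_def by (rule topology_generated_by_Basis) blast

lemma continuous_map_compact_open_eval: "continuous_map compact_open euclidean (\<lambda>f. f p)"
  unfolding continuous_map_def using openin_compact_open[of "{p}"] by auto

lemma continuous_map_compact_open_comp:
  fixes g :: "'c::topological_space \<Rightarrow> 'd::topological_space"
    and h :: "'a::topological_space \<Rightarrow> 'b::topological_space"
  assumes "continuous_on UNIV g" "continuous_on UNIV h"
  shows "continuous_map compact_open compact_open (\<lambda>f. g \<circ> f \<circ> h)"
proof (rule continuous_map_into_compact_open)
  fix K :: "'a set" and U :: "'d set" assume "compact K" "open U"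
  then have "openin compact_open {f. f ` (h ` K) \<subseteq> g -` U}"
    using assms by (intro openin_compact_open)
      (auto intro: compact_continuous_image continuous_on_subset open_vimage)
  moreover have "{f. f ` (h ` K) \<subseteq> g -` U} = {f \<in> topspace compact_open. (g \<circ> f \<circ> h) ` K \<subseteq> U}"
    by auto
  ultimately show "openin compact_open {f \<in> topspace compact_open. (g \<circ> f \<circ> h) ` K \<subseteq> U}"
    by simp
qed

lemma continuous_on_isometry: "f \<in> isometries \<Longrightarrow> continuous_on UNIV f"
  unfolding isometries_def continuous_on_iff by auto

section \<open>Comparison of the metric with distances of unit representatives\<close>

lemma cos_dist_abs_cproj:
  assumes "norm u = 1" "norm v = 1"
  shows "cos (dist (abs_cproj u) (abs_cproj v)) = cmod (cinner u v)"
    "dist (abs_cproj u) (abs_cproj v) \<le> pi"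
proof -
  have "u \<noteq> 0" "v \<noteq> 0" using assms by auto
  moreover have "cmod (cinner u v) \<le> 1" using cinner_Cauchy_Schwarz[of u v] assms by simp
  ultimately show "cos (dist (abs_cproj u) (abs_cproj v)) = cmod (cinner u v)"
    "dist (abs_cproj u) (abs_cproj v) \<le> pi"
    using assms norm_ge_zero[of "cinner u v"]
    by (auto simp: dist_abs_cproj intro!: cos_arccos arccos_ubound simp del: norm_ge_zero)
qed

lemma norm_diff_unit:
  assumes "norm u = 1" "norm v = 1"
  shows "(norm (u - v))\<^sup>2 = 2 - 2 * Re (cinner u v)"
proof -
  have "complex_of_real ((norm (u - v))\<^sup>2) = 2 - cinner u v - cnj (cinner u v)"
    unfolding cinner_self[symmetric]
    using assms cinner_self[of u] cinner_self[of v] cinner_commute[of v u]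
    by (simp add: cinner_diff_left cinner_diff_right)
  then have "Re (complex_of_real ((norm (u - v))\<^sup>2)) = Re (2 - cinner u v - cnj (cinner u v))"
    by (rule arg_cong)
  then show ?thesis by simp
qed

text \<open>The squared norm is \<open>2 - 2 Re (cinner u v)\<close>, and
  \<open>Re (cinner u v)\<close> is at most the cosine of the distance. Capping \<open>e\<close> at
  \<open>pi\<close> keeps the argument in the range where \<open>cos\<close> is decreasing.\<close>

lemma dist_abs_cproj_less:
  assumes "norm u = 1" "norm v = 1" "0 < e" "(norm (u - v))\<^sup>2 < 2 - 2 * cos (min e pi)"
  shows "dist (abs_cproj u) (abs_cproj v) < e"
proof (rule ccontr)
  assume "\<not> ?thesis"
  then have "min e pi \<le> dist (abs_cproj u) (abs_cproj v)"
    by auto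
  then have "cos (dist (abs_cproj u) (abs_cproj v)) \<le> cos (min e pi)"
    using assms(3) cos_dist_abs_cproj(2)[OF assms(1,2)] by (intro cos_monotone_0_pi_le) auto
  then have "cmod (cinner u v) \<le> cos (min e pi)"
    using cos_dist_abs_cproj(1)[OF assms(1,2)] by simp
  then have "Re (cinner u v) \<le> cos (min e pi)"
    using complex_Re_le_cmod[of "cinner u v"] by linarith
  then show False using assms(4) norm_diff_unit[OF assms(1,2)] by simp
qed

lemma norm_matrix_vector_le: "norm (A *v x) \<le> norm A * norm (x :: complex^'n)"
proof -
  have "norm ((A *v x) $ i) \<le> norm (A $ i) * norm x" for i
  proof -
    have "(A *v x) $ i = cinner (A $ i) (\<chi> j. cnj (x $ j))"
      by (simp add: matrix_vector_mult_def cinner_def)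
    moreover have "norm (\<chi> j. cnj (x $ j)) = norm x" by (simp add: norm_vec_def)
    ultimately show ?thesis by (metis cinner_Cauchy_Schwarz)
  qed
  then have "norm (A *v x) \<le> L2_set (\<lambda>i. norm (A $ i) * norm x) UNIV"
    unfolding norm_vec_def[of "A *v x"] by (intro L2_set_mono) auto
  also have "\<dots> = norm A * norm x"
    by (simp add: norm_vec_def[of A] L2_set_left_distrib)
  finally show ?thesis .
qed

text \<open>A compact image inside an open set has a uniform margin \<open>e\<close>. Close matrices
  move all unit vectors by a uniformly small amount, so the same neighbourhood of \<open>t\<close>
  serves every point of \<open>K\<close>.\<close>

lemma continuous_map_proj_action:
  fixes F :: "'a::metric_space \<Rightarrow> complex^'n^'n"
  assumes "continuous_on UNIV F" and un: "\<And>t. F t \<in> unitary"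
  shows "continuous_map euclidean compact_open (\<lambda>t. proj_action (F t))"
proof (rule continuous_map_into_compact_open)
  fix K U :: "'n cproj set" assume K: "compact K" and U: "open U"
  have "\<exists>d>0. ball t d \<subseteq> {t. proj_action (F t) ` K \<subseteq> U}" if t: "proj_action (F t) ` K \<subseteq> U" for t
  proof -
    have "compact (proj_action (F t) ` K)"
      using K continuous_on_isometry[OF proj_action_isometry[OF un]]
      by (blast intro: compact_continuous_image continuous_on_subset)
    then obtain e where e: "e > 0" "(\<Union>p\<in>proj_action (F t) ` K. ball p e) \<subseteq> U"
      using compact_subset_open_imp_ball_epsilon_subset[OF _ U t] by blast
    \<comment> \<open>The threshold of \<open>dist_abs_cproj_less\<close> for the margin
      \<open>e\<close>.\<close>
    define m where "m = 2 - 2 * cos (min e pi)"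
    have "cos (min e pi) < cos 0"
      using e by (intro cos_monotone_0_pi) auto
    then have "sqrt m > 0" by (simp add: m_def)
    then obtain d where d: "d > 0" "\<And>s. dist s t < d \<Longrightarrow> dist (F s) (F t) < sqrt m"
      using assms(1) unfolding continuous_on_iff by (metis UNIV_I)
    have "proj_action (F s) p \<in> U" if s: "s \<in> ball t d" and p: "p \<in> K" for s p
    proof -
      obtain v where v: "norm v = 1" "v \<noteq> 0" "p = abs_cproj v" using abs_cproj_surj[of 1] by auto
      have "F t *v v - F s *v v = (F t - F s) *v v"
        by (simp add: matrix_vector_mult_diff_rdistrib)
      then have "norm (F t *v v - F s *v v) \<le> norm (F t - F s)"
        using norm_matrix_vector_le[of "F t - F s" v] v by simp
      also have "\<dots> < sqrt m" using d(2)[of s] s by (simp add: dist_commute dist_norm norm_minus_commute)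
      finally have "(norm (F t *v v - F s *v v))\<^sup>2 < m"
        using \<open>sqrt m > 0\<close> by (metis norm_ge_zero real_sqrt_less_iff real_sqrt_unique)
      then have "dist (proj_action (F t) p) (proj_action (F s) p) < e"
        using v e unfolding m_def
        by (simp add: proj_action_unitary[OF un] dist_abs_cproj_less unitary_norm[OF un])
      then show ?thesis using e(2) p by (auto simp: subset_iff)
    qed
    with d(1) show ?thesis by blast
  qed
  then show "openin euclidean {t \<in> topspace euclidean. proj_action (F t) ` K \<subseteq> U}"
    by (simp add: open_contains_ball)
qed

section \<open>The embedding by rank-one projections\<close>

definition outer :: "complex^'n \<Rightarrow> complex^'n^'n" where
  "outer v = (\<chi> i j. v $ i * cnj (v $ j))"

lemma outer_scale: "outer (c *s v) = mat (complex_of_real ((cmod c)\<^sup>2)) ** outer v"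
  by (simp add: outer_def vec_eq_iff mat_mult_component complex_norm_square mult_ac
      del: of_real_power)

text \<open>The orthogonal projection onto the line \<open>p\<close>. The chosen
  \<open>rep_cproj p\<close> has arbitrary norm and phase; the division removes the norm and
  \<open>outer\<close> the phase.\<close>

definition proj_mat :: "'n::finite cproj \<Rightarrow> complex^'n^'n" where
  "proj_mat p = mat (complex_of_real (1 / (norm (rep_cproj p))\<^sup>2)) ** outer (rep_cproj p)"

lemma proj_mat_abs:
  assumes "v \<noteq> 0"
  shows "proj_mat (abs_cproj v) = mat (complex_of_real (1 / (norm v)\<^sup>2)) ** outer v"
proof -
  let ?v = "rep_cproj (abs_cproj v)"
  obtain c where c: "?v = c *s v"
    using abs_cproj_eq_iff[OF assms rep_cproj_nonzero] abs_rep_cproj by metis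
  then have "c \<noteq> 0" using rep_cproj_nonzero[of "abs_cproj v"] by auto
  then show ?thesis
    unfolding proj_mat_def c using assms
    by (simp add: outer_scale matrix_mul_assoc mat_mult_mat norm_scale_vec power_mult_distrib)
qed

lemma proj_mat_unit: "norm v = 1 \<Longrightarrow> proj_mat (abs_cproj v) = outer v"
  by (subst proj_mat_abs) auto

text \<open>Rotating the phase until the inner product is real and nonnegative makes the chord equal
  to \<open>2 sin (dist / 2)\<close>, which is at most the distance.\<close>

lemma near_representative:
  assumes "norm v = 1"
  obtains u where "norm u = 1" "p = abs_cproj u" "norm (u - v) \<le> dist p (abs_cproj v)"
proof -
  obtain w where w: "norm w = 1" "w \<noteq> 0" "p = abs_cproj w" using abs_cproj_surj[of 1] by auto
  \<comment> \<open>For orthogonal vectors any phase will do, hence the default 1.\<close>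
  define a where "a = (if cinner w v = 0 then 1 else cnj (cinner w v) / cmod (cinner w v))"
  have a: "cmod a = 1" "a * cinner w v = cmod (cinner w v)"
    by (auto simp: a_def norm_divide complex_norm_square[symmetric] power2_eq_square mult.commute)
  define u where "u = a *s w"
  have u: "norm u = 1" "p = abs_cproj u" using w a(1)
    using abs_cproj_scale[of a w] by (force simp: u_def norm_scale_vec)+
  have "Re (cinner u v) = cmod (cinner u v)"
    by (simp add: u_def cinner_scale_left a norm_mult)
  then have "(norm (u - v))\<^sup>2 = 2 - 2 * cos (dist p (abs_cproj v))"
    using norm_diff_unit[OF u(1) assms] cos_dist_abs_cproj[OF u(1) assms] u(2) by simp
  also have "\<dots> = (2 * sin (dist p (abs_cproj v) / 2))\<^sup>2"
    using cos_double_sin[of "dist p (abs_cproj v) / 2"] by (simp add: power_mult_distrib)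
  also have "\<dots> \<le> (dist p (abs_cproj v))\<^sup>2"
    using abs_sin_x_le_abs_x[of "dist p (abs_cproj v) / 2"] by (intro power2_le_iff_abs_le[THEN iffD2]) auto
  finally have "norm (u - v) \<le> dist p (abs_cproj v)" by (simp add: power2_le_iff_abs_le)
  with u show ?thesis using that by blast
qed

lemma continuous_on_proj_mat: "continuous_on UNIV proj_mat"
  unfolding continuous_on_iff
proof (intro ballI allI impI)
  fix q :: "'a cproj" and e :: real assume "e > 0"
  obtain v where v: "norm v = 1" "v \<noteq> 0" "q = abs_cproj v" using abs_cproj_surj[of 1] by auto
  have "continuous_on UNIV (outer :: complex^'a \<Rightarrow> _)"
    unfolding outer_def by (intro continuous_intros)
  then obtain d where d: "d > 0" "\<And>u. dist u v < d \<Longrightarrow> dist (outer u) (outer v) < e"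
    using \<open>e > 0\<close> unfolding continuous_on_iff by (metis UNIV_I)
  have "dist (proj_mat p) (proj_mat q) < e" if p: "dist p q < d" for p
  proof -
    obtain u where u: "norm u = 1" "p = abs_cproj u" "norm (u - v) \<le> dist p q"
      using near_representative[OF v(1)] v(3) by metis
    then show ?thesis using d(2)[of u] p v by (simp add: proj_mat_unit dist_norm)
  qed
  with d(1) show "\<exists>d>0. \<forall>p\<in>UNIV. dist p q < d \<longrightarrow> dist (proj_mat p) (proj_mat q) < e" by blast
qed

text \<open>The Bargmann invariant of three points. It distinguishes unitary from antiunitary maps,
  which conjugate it.\<close>

definition bargmann :: "'n::finite cproj \<Rightarrow> 'n cproj \<Rightarrow> 'n cproj \<Rightarrow> complex" where
  "bargmann p q r = (\<Sum>i\<in>UNIV. \<Sum>j\<in>UNIV. \<Sum>k\<in>UNIV.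
     proj_mat p $ i $ j * proj_mat q $ j $ k * proj_mat r $ k $ i)"

lemma bargmann_abs:
  assumes "u \<noteq> 0" "v \<noteq> 0" "w \<noteq> 0"
  shows "bargmann (abs_cproj u) (abs_cproj v) (abs_cproj w) =
    cinner u w * cinner v u * cinner w v / complex_of_real ((norm u * norm v * norm w)\<^sup>2)"
proof -
  have "cinner u w * cinner v u * cinner w v = (\<Sum>i\<in>UNIV. u $ i * cnj (w $ i)) *
      (\<Sum>j\<in>UNIV. v $ j * cnj (u $ j)) * (\<Sum>k\<in>UNIV. w $ k * cnj (v $ k))"
    by (simp add: cinner_def)
  also have "\<dots> = (\<Sum>i\<in>UNIV. \<Sum>j\<in>UNIV. \<Sum>k\<in>UNIV.
      (u $ i * cnj (w $ i)) * (v $ j * cnj (u $ j)) * (w $ k * cnj (v $ k)))"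
    by (simp only: sum_distrib_left[symmetric] sum_distrib_right[symmetric])
  finally show ?thesis
    unfolding bargmann_def
    by (simp add: proj_mat_abs[OF assms(1)] proj_mat_abs[OF assms(2)] proj_mat_abs[OF assms(3)]
        mat_mult_component outer_def sum_divide_distrib power_mult_distrib mult_ac)
qed

lemma continuous_map_bargmann:
  "continuous_map compact_open euclidean
    (\<lambda>f. bargmann (f p) (f q) (f r :: 'n::finite cproj))"
proof -
  have "continuous_map compact_open (prod_topology euclidean (prod_topology euclidean euclidean))
      (\<lambda>f. (f p, f q, f r :: 'n cproj))"
    by (intro continuous_map_pairedI continuous_map_compact_open_eval)
  moreover have "continuous_on UNIV (\<lambda>(x, y, z). bargmann x y (z :: 'n cproj))"
    unfolding bargmann_def split_def
    by (intro continuous_intros continuous_on_compose2[OF continuous_on_proj_mat]) auto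
  ultimately have "continuous_map compact_open euclidean
      ((\<lambda>(x, y, z). bargmann x y (z :: 'n cproj)) \<circ> (\<lambda>f. (f p, f q, f r)))"
    by (intro continuous_map_compose) auto
  then show ?thesis by (simp add: o_def)
qed

section \<open>The identity component of the isometry group\<close>

definition diag_mat :: "complex^'n \<Rightarrow> complex^'n^'n" where
  "diag_mat d = (\<chi> i j. if i = j then d $ i else 0)"

lemma diag_mat_vec: "diag_mat d *v x = (\<chi> i. d $ i * x $ i)"
  by (simp add: diag_mat_def matrix_vector_mult_def vec_eq_iff if_distrib[of "\<lambda>x. x * _"]
      cong: if_cong)

lemma diag_mat_axis: "diag_mat d *v axis i 1 = d $ i *s axis i 1"
  by (simp add: diag_mat_vec vec_eq_iff axis_def)

lemma diag_mat_unitary: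
  assumes "\<And>i. cmod (d $ i) = 1" shows "diag_mat d \<in> unitary"
  using assms by (auto simp: unitary_iff_columns diag_mat_axis cinner_scale_left cinner_scale_right
      mult.commute[of "cnj _"] complex_norm_square[symmetric]) (auto simp: axis_def)

text \<open>Angles in a real vector space present the torus as a continuous image of a connected set
  and turn its product into addition.\<close>

definition diag_cis :: "real^'n \<Rightarrow> complex^'n^'n" where
  "diag_cis \<theta> = diag_mat (\<chi> i. cis (\<theta> $ i))"

lemma diag_cis_unitary: "diag_cis \<theta> \<in> unitary"
  unfolding diag_cis_def by (intro diag_mat_unitary) simp

lemma diag_cis_0: "diag_cis 0 = mat 1"
  by (simp add: diag_cis_def diag_mat_def mat_def vec_eq_iff)

lemma diag_cis_add: "diag_cis \<theta> ** diag_cis \<eta> = diag_cis (\<theta> + \<eta>)"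
  by (simp add: matrix_eq diag_cis_def diag_mat_vec vec_eq_iff cis_mult mult.assoc[symmetric]
      flip: matrix_vector_mul_assoc)

lemma adjoint_diag_cis: "adjoint_mat (diag_cis \<theta>) = diag_cis (- \<theta>)"
  by (simp add: adjoint_mat_def diag_cis_def diag_mat_def vec_eq_iff cis_cnj)

lemma unitary_diagonal_cis:
  assumes "D \<in> unitary" "\<And>i j. i \<noteq> j \<Longrightarrow> D $ i $ j = 0"
  obtains \<theta> where "D = diag_cis \<theta>"
proof
  have n1: "cmod (D $ i $ i) = 1" for i
  proof -
    have "D *v axis i 1 = D $ i $ i *s axis i 1"
      using assms(2) by (simp add: vec_eq_iff matrix_vector_mult_axis) (auto simp: axis_def)
    then show ?thesis
      using unitary_norm[OF assms(1), of "axis i 1"] by (simp add: norm_scale_vec)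
  qed
  have "cis (Arg (D $ i $ i)) = D $ i $ i" for i
  proof -
    have "D $ i $ i \<noteq> 0" using n1[of i] by auto
    then show ?thesis by (simp add: cis_Arg sgn_eq n1)
  qed
  then show "D = diag_cis (\<chi> i. Arg (D $ i $ i))"
    using assms(2) by (simp add: diag_cis_def diag_mat_def vec_eq_iff)
qed

lemma carrier_Iso0: "carrier Iso0 = connected_component_of_set (subtopology compact_open isometries) id"
  by (simp add: Iso0_def)

lemma Iso0_imp_isometry: "f \<in> carrier Iso0 \<Longrightarrow> f \<in> isometries"
  using connected_component_of_subset_topspace[of "subtopology compact_open isometries" id]
  by (auto simp: carrier_Iso0)

lemma connectedin_conj_diag_cis:
  assumes "G \<in> unitary"
  shows "connectedin compact_open (range (\<lambda>\<theta>. proj_action (G ** diag_cis \<theta> ** adjoint_mat G)))"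
proof (rule connectedin_continuous_map_image)
  have "continuous_on UNIV (\<lambda>\<theta>. G ** diag_cis \<theta> ** adjoint_mat G)"
  proof -
    have "G ** diag_cis \<theta> ** adjoint_mat G =
        (\<chi> i j. \<Sum>k\<in>UNIV. G $ i $ k * cis (\<theta> $ k) * adjoint_mat G $ k $ j)" for \<theta>
      by (simp add: matrix_matrix_mult_def diag_cis_def diag_mat_def if_distrib[of "\<lambda>x. _ * x"]
          cong: if_cong)
    then show ?thesis by (simp add: cis_conv_exp) (intro continuous_intros)
  qed
  then show "continuous_map euclidean compact_open
      (\<lambda>\<theta>. proj_action (G ** diag_cis \<theta> ** adjoint_mat G))"
    by (intro continuous_map_proj_action unitary_mult assms diag_cis_unitary unitary_adjoint)
  show "connectedin euclidean (UNIV :: (real^'a) set)" by (simp add: convex_connected)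
qed

lemma unitary_in_Iso0:
  assumes A: "A \<in> unitary" shows "proj_action A \<in> carrier Iso0"
proof -
  have "\<exists>G. G \<in> unitary \<and> (\<forall>i j. i \<noteq> j \<longrightarrow> (adjoint_mat G ** A ** G) $ i $ j = 0)"
    by (rule commuting_unitary_diagonal[of "{A}"]) (use A in auto)
  then obtain G where G: "G \<in> unitary" "\<And>i j. i \<noteq> j \<Longrightarrow> (adjoint_mat G ** A ** G) $ i $ j = 0"
    by blast
  have "adjoint_mat G ** A ** G \<in> unitary"
    by (intro unitary_mult unitary_adjoint A G(1))
  then obtain \<theta> where \<theta>: "adjoint_mat G ** A ** G = diag_cis \<theta>"
    using unitary_diagonal_cis[OF _ G(2)] by blast
  have "G ** (adjoint_mat G ** A ** G) ** adjoint_mat G = (G ** adjoint_mat G) ** A ** (G ** adjoint_mat G)"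
    by (simp only: matrix_mul_assoc)
  then have AG: "G ** diag_cis \<theta> ** adjoint_mat G = A" by (simp add: \<theta> unitaryD[OF G(1)])
  define S where "S = range (\<lambda>\<theta>. proj_action (G ** diag_cis \<theta> ** adjoint_mat G))"
  have "S \<subseteq> isometries"
    unfolding S_def using G(1)
    by (auto intro!: proj_action_isometry unitary_mult diag_cis_unitary unitary_adjoint)
  then have conn: "connectedin (subtopology compact_open isometries) S"
    using connectedin_conj_diag_cis[OF G(1)] by (simp add: S_def connectedin_subtopology)
  have id: "id \<in> S"
    unfolding S_def by (rule range_eqI[of _ _ 0])
      (simp add: diag_cis_0 unitaryD[OF G(1)] proj_action_mat)
  have "proj_action A \<in> S"
    unfolding S_def by (rule range_eqI[of _ _ \<theta>]) (simp add: AG)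
  then show ?thesis
    unfolding carrier_Iso0 using connected_component_of_maximal[OF conn id] by (rule subsetD[rotated])
qed

lemma bargmann_unitary:
  assumes "A \<in> unitary"
  shows "bargmann (proj_action A p) (proj_action A q) (proj_action A r) = bargmann p q r"
proof -
  obtain u v w where "u \<noteq> 0" "p = abs_cproj u" "v \<noteq> 0" "q = abs_cproj v" "w \<noteq> 0" "r = abs_cproj w"
    using abs_cproj_surj[of 1] by (metis zero_less_one)
  then show ?thesis using assms
    by (simp add: proj_action_unitary bargmann_abs unitary_nonzero unitary_cinner unitary_norm)
qed

lemma axis_1_nonzero [simp]: "axis i (1 :: complex) \<noteq> 0"
  by (simp add: axis_eq_0_iff)

lemma one_vec_nonzero [simp]: "(1 :: complex^'n) \<noteq> 0"
  by (simp add: vec_eq_iff)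

text \<open>The argument for Wigner's theorem: an isometry fixing the coordinate points and
  \<open>[1 : ... : 1]\<close> fixes all \<open>[e_i + e_j]\<close> and maps \<open>[e_i + \<i> e_j]\<close> to \<open>[e_i \<plusminus> \<i> e_j]\<close>;
  if the sign is always positive, it is the identity.\<close>

definition normalized :: "('n::finite cproj \<Rightarrow> 'n cproj) \<Rightarrow> bool" where
  "normalized f \<longleftrightarrow> f \<in> isometries \<and> (\<forall>i. f (abs_cproj (axis i 1)) = abs_cproj (axis i 1)) \<and>
     f (abs_cproj 1) = abs_cproj 1"

text \<open>The images of the coordinate points are represented by orthonormal vectors, which a
  unitary matrix takes back to the axes. The freedom left is a diagonal matrix of phases, used to
  restore \<open>[1 : ... : 1]\<close>.\<close>

lemma normalize_isometry:
  fixes f :: "'n::finite cproj \<Rightarrow> 'n cproj"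
  assumes f: "f \<in> isometries"
  obtains A where "A \<in> unitary" "normalized (proj_action A \<circ> f)"
proof -
  have "\<forall>i. \<exists>v. norm v = 1 \<and> f (abs_cproj (axis i 1)) = abs_cproj v"
    using abs_cproj_surj[of 1] by (metis zero_less_one)
  then obtain g where g: "\<And>i. norm (g i) = 1" "\<And>i. f (abs_cproj (axis i 1)) = abs_cproj (g i)"
    by metis
  define G :: "complex^'n^'n" where "G = (\<chi> i j. g j $ i)"
  have col: "G *v axis i 1 = g i" for i
    by (simp add: vec_eq_iff matrix_vector_mult_axis) (simp add: G_def)
  have "cinner (g i) (g j) = (if i = j then 1 else 0)" for i j
  proof (cases "i = j")
    case False
    have "cmod (cinner (g i) (g j)) = cmod (cinner (axis i 1 :: complex^'n) (axis j 1))"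
      by (rule isometry_cmod_cinner[OF f]) (simp_all add: g)
    then show ?thesis using False by simp (simp add: axis_def)
  qed (simp add: cinner_self g)
  then have G: "G \<in> unitary" by (simp add: unitary_iff_columns col)
  define f1 where "f1 = proj_action (adjoint_mat G) \<circ> f"
  have f1: "f1 \<in> isometries"
    unfolding f1_def by (intro isometries_comp proj_action_isometry unitary_adjoint G f)
  have f1e: "f1 (abs_cproj (axis i 1)) = abs_cproj (axis i 1)" for i
  proof -
    have "f1 (abs_cproj (axis i 1)) = abs_cproj (adjoint_mat G *v g i)"
      using g(1)[of i] by (simp add: f1_def g(2)) (metis G norm_zero proj_action_unitary unitary_adjoint zero_neq_one)
    also have "\<dots> = abs_cproj (axis i 1)"
      by (simp add: matrix_vector_mul_assoc unitaryD[OF G] flip: col)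
    finally show ?thesis .
  qed
  obtain t where t: "norm t = norm (1 :: complex^'n)" "t \<noteq> 0" "f1 (abs_cproj 1) = abs_cproj t"
    using abs_cproj_surj[of "norm (1 :: complex^'n)"] by (metis one_vec_nonzero zero_less_norm_iff)
  have ti: "cmod (t $ i) = 1" for i
    using isometry_cmod_cinner[OF f1 _ _ t(3) f1e[of i]] t by simp
  \<comment> \<open>Since \<open>t\<close> was chosen with the norm of the all-ones vector, all its
    entries have modulus 1, so \<open>cnj (t $ i)\<close> is the inverse of \<open>t $ i\<close>.
    Thus \<open>D\<close> sends \<open>t\<close> to 1 and only rescales the axes.\<close>
  define D where "D = diag_mat (\<chi> i. cnj (t $ i))"
  have D: "D \<in> unitary" unfolding D_def by (intro diag_mat_unitary) (simp add: ti)
  have Dt: "D *v t = 1"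
    by (simp add: D_def diag_mat_vec vec_eq_iff mult.commute[of "cnj _"] complex_norm_square[symmetric] ti)
  have De: "proj_action D (abs_cproj (axis i 1)) = abs_cproj (axis i 1)" for i
  proof -
    have "t $ i \<noteq> 0" using ti[of i] by auto
    then show ?thesis
      by (simp add: proj_action_unitary[OF D]) (simp add: D_def diag_mat_axis abs_cproj_scale)
  qed
  have "normalized (proj_action D \<circ> f1)"
    using t by (simp add: normalized_def isometries_comp f1 proj_action_isometry D De f1e
        proj_action_unitary[OF D] Dt)
  then have "normalized (proj_action (D ** adjoint_mat G) \<circ> f)"
    by (simp add: proj_action_mult D G unitary_adjoint f1_def comp_assoc)
  with D G show ?thesis using that unitary_mult unitary_adjoint by blast
qed

definition two_pt :: "'n::finite \<Rightarrow> 'n \<Rightarrow> complex \<Rightarrow> complex^'n" where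
  "two_pt i j c = axis i 1 + c *s axis j 1"

lemma cinner_two_pt: "cinner w (two_pt i j c) = w $ i + cnj c * w $ j"
  using cinner_commute[of w "two_pt i j c"] cinner_commute[of w "axis i 1"] cinner_commute[of w "axis j 1"]
  by (simp add: two_pt_def cinner_add_left cinner_scale_left)

lemma two_pt_component:
  "i \<noteq> j \<Longrightarrow> two_pt i j c $ k = (if k = i then 1 else if k = j then c else 0)"
  by (simp add: two_pt_def axis_def)

lemma two_pt_nonzero: "i \<noteq> j \<Longrightarrow> two_pt i j c \<noteq> 0"
  by (metis two_pt_component zero_index zero_neq_one)

lemma norm_two_pt: 
  assumes "i \<noteq> j" "cmod c = 1" shows "(norm (two_pt i j c))\<^sup>2 = 2"
proof -
  have "complex_of_real ((norm (two_pt i j c))\<^sup>2) = 2"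
    unfolding cinner_self[symmetric] cinner_two_pt using assms
    by (simp add: two_pt_component complex_norm_square[symmetric] mult.commute[of "cnj _"])
  then show ?thesis by (metis of_real_eq_iff of_real_numeral)
qed

lemma normalized_coordinates:
  assumes f: "normalized f" and w: "w \<noteq> 0"
  obtains z where "z \<noteq> 0" "f (abs_cproj w) = abs_cproj z" "norm z = norm w"
    "\<forall>i. cmod (z $ i) = cmod (w $ i)" "cmod (cinner z 1) = cmod (cinner w 1)"
proof -
  obtain z where z: "norm z = norm w" "z \<noteq> 0" "f (abs_cproj w) = abs_cproj z"
    using abs_cproj_surj[of "norm w"] w by (metis zero_less_norm_iff)
  have iso: "f \<in> isometries" using f by (simp add: normalized_def)
  have "cmod (z $ i) = cmod (w $ i)" for i
    using isometry_cmod_cinner[OF iso w axis_1_nonzero z(3), of i "axis i 1"] f z(1)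
    by (simp add: normalized_def)
  moreover have "cmod (cinner z 1) = cmod (cinner w 1)"
    using isometry_cmod_cinner[OF iso w one_vec_nonzero z(3), of 1] f z(1)
    by (simp add: normalized_def)
  ultimately show ?thesis using that z by blast
qed

lemma cinner_one: "cinner w 1 = (\<Sum>k\<in>UNIV. w $ k)"
  by (simp add: cinner_def)

text \<open>The coordinate points fix the moduli of the entries, leaving one relative phase
  \<open>d\<close>; the point \<open>[1 : ... : 1]\<close> gives
  \<open>cmod (1 + d) = cmod (1 + c)\<close>, which fixes its real part.\<close>

lemma normalized_two_pt:
  assumes f: "normalized f" and ij: "i \<noteq> j" and c: "cmod c = 1"
  obtains d where "d = c \<or> d = cnj c" "f (abs_cproj (two_pt i j c)) = abs_cproj (two_pt i j d)"
proof -
  obtain z where z: "z \<noteq> 0" "f (abs_cproj (two_pt i j c)) = abs_cproj z"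
    "\<forall>k. cmod (z $ k) = cmod (two_pt i j c $ k)"
    "cmod (cinner z 1) = cmod (cinner (two_pt i j c) 1)"
    using normalized_coordinates[OF f two_pt_nonzero[OF ij]] by metis
  have zij: "cmod (z $ i) = 1" "cmod (z $ j) = 1" "k \<noteq> i \<Longrightarrow> k \<noteq> j \<Longrightarrow> z $ k = 0" for k
    using z(3)[rule_format, of i] z(3)[rule_format, of j] z(3)[rule_format, of k] ij c
    by (simp_all add: two_pt_component)
  \<comment> \<open>The quotient of the two entries, as \<open>z $ i\<close> has modulus 1.\<close>
  define d where "d = cnj (z $ i) * z $ j"
  have d: "cmod d = 1" using zij by (simp add: d_def norm_mult)
  have zi: "z $ i * cnj (z $ i) = 1" using zij by (simp add: complex_norm_square[symmetric])
  have zd: "z = z $ i *s two_pt i j d"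
    using zij ij zi by (auto simp: vec_eq_iff two_pt_component d_def mult.assoc[symmetric])
  have "z $ i \<noteq> 0" using zij by auto
  then have fd: "f (abs_cproj (two_pt i j c)) = abs_cproj (two_pt i j d)"
    using z(2) zd abs_cproj_scale two_pt_nonzero[OF ij] by metis
  have sum: "cinner (two_pt i j e) 1 = 1 + e" for e
  proof -
    have "cinner (two_pt i j e) 1 = (\<Sum>k\<in>UNIV. (if k = i then 1 else 0) + (if k = j then e else 0))"
      unfolding cinner_one using ij by (intro sum.cong) (auto simp: two_pt_component)
    then show ?thesis by (simp add: sum.distrib)
  qed
  have "cmod (cinner z 1) = cmod (1 + d)"
    by (subst zd) (simp add: cinner_scale_left norm_mult zij sum)
  then have "cmod (1 + d) = cmod (1 + c)" using z(4) sum by simp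
  then have "(cmod (1 + d))\<^sup>2 = (cmod (1 + c))\<^sup>2" by simp
  moreover have d2: "(Re d)\<^sup>2 + (Im d)\<^sup>2 = 1" "(Re c)\<^sup>2 + (Im c)\<^sup>2 = 1"
    using d c by (simp_all flip: cmod_power2)
  ultimately have re: "Re d = Re c"
    by (simp add: cmod_power2 power2_sum)
  then have "(Im d)\<^sup>2 = (Im c)\<^sup>2" using d2 by simp
  then have "d = c \<or> d = cnj c" using re by (auto simp: power2_eq_iff complex_eq_iff)
  with fd show ?thesis using that by blast
qed

text \<open>The values at \<open>d = \<i>\<close> and \<open>d = - \<i>\<close> differ, which makes
  the sign visible. The denominator is the product 1 * 2 * 2 of the squared norms.\<close>

lemma bargmann_two_pt:
  assumes "i \<noteq> j" "cmod d = 1"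
  shows "bargmann (abs_cproj (axis i 1)) (abs_cproj (two_pt i j 1)) (abs_cproj (two_pt i j d)) =
    (1 + d) / 4"
proof -
  have "cinner (axis i 1) (two_pt i j d) = 1"
    using assms(1) by (simp add: cinner_two_pt) (simp add: axis_def)
  moreover have "cinner (two_pt i j d) (two_pt i j 1) = 1 + d"
    using assms(1) by (simp add: cinner_two_pt two_pt_component)
  moreover have "cinner (two_pt i j 1) (axis i 1) = 1"
    using assms(1) by (simp add: two_pt_component)
  moreover have "(norm (axis i 1 :: complex^'a) * norm (two_pt i j 1) * norm (two_pt i j d))\<^sup>2 = 4"
    using assms by (simp add: power_mult_distrib norm_two_pt)
  ultimately show ?thesis
    using assms(1) by (simp only: bargmann_abs axis_1_nonzero two_pt_nonzero not_False_eq_True) simp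
qed

lemma normalized_bargmann:
  assumes f: "normalized f" and ij: "i \<noteq> j"
  obtains d where "d = \<i> \<or> d = - \<i>" "f (abs_cproj (two_pt i j \<i>)) = abs_cproj (two_pt i j d)"
    "f (abs_cproj (two_pt i j 1)) = abs_cproj (two_pt i j 1)"
    "bargmann (f (abs_cproj (axis i 1))) (f (abs_cproj (two_pt i j 1))) (f (abs_cproj (two_pt i j \<i>))) =
      (1 + d) / 4"
proof -
  obtain d where d: "d = \<i> \<or> d = - \<i>" "f (abs_cproj (two_pt i j \<i>)) = abs_cproj (two_pt i j d)"
    using normalized_two_pt[OF f ij, of \<i>] by (metis complex_cnj_i norm_ii)
  have 1: "f (abs_cproj (two_pt i j 1)) = abs_cproj (two_pt i j 1)"
    using normalized_two_pt[OF f ij, of 1] by (metis complex_cnj_one norm_one)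
  have "cmod d = 1" using d(1) by auto
  then have "bargmann (f (abs_cproj (axis i 1))) (f (abs_cproj (two_pt i j 1))) (f (abs_cproj (two_pt i j \<i>))) =
      (1 + d) / 4"
    using f ij by (simp add: 1 d(2) normalized_def bargmann_two_pt)
  with d 1 show ?thesis using that by blast
qed

text \<open>Normalizing by a unitary matrix leaves the invariant unchanged, so on all of
  \<open>Iso0\<close> it has at most two values. By connectedness it is constant, and
  \<open>id\<close> supplies the value.\<close>

lemma Iso0_bargmann:
  fixes f :: "'n::finite cproj \<Rightarrow> 'n cproj"
  assumes f: "f \<in> carrier Iso0" and ij: "i \<noteq> j"
  shows "bargmann (f (abs_cproj (axis i 1))) (f (abs_cproj (two_pt i j 1))) (f (abs_cproj (two_pt i j \<i>)))
    = (1 + \<i>) / 4" (is "?b f = _")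
proof -
  have "?b h \<in> {(1 + \<i>) / 4, (1 - \<i>) / 4}" if h: "h \<in> carrier Iso0" for h
  proof -
    obtain A where A: "A \<in> unitary" "normalized (proj_action A \<circ> h)"
      using normalize_isometry[OF Iso0_imp_isometry[OF h]] by metis
    obtain d where "d = \<i> \<or> d = - \<i>" "?b (proj_action A \<circ> h) = (1 + d) / 4"
      using normalized_bargmann[OF A(2) ij] by metis
    then show ?thesis by (auto simp: bargmann_unitary[OF A(1)])
  qed
  then have sub: "?b ` carrier Iso0 \<subseteq> {(1 + \<i>) / 4, (1 - \<i>) / 4}" by (rule image_subsetI)
  have "finite (?b ` carrier Iso0)"
    by (rule finite_subset[OF sub]) simp
  moreover have conn: "connectedin compact_open (carrier Iso0 :: ('n cproj \<Rightarrow> 'n cproj) set)"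
    unfolding carrier_Iso0
    by (rule conjunct1[OF iffD1[OF connectedin_subtopology connectedin_connected_component_of]])
  then have "connected (?b ` carrier Iso0)"
    using connectedin_continuous_map_image[OF continuous_map_bargmann conn] by simp
  ultimately have "?b ` carrier Iso0 = {} \<or> (\<exists>a. ?b ` carrier Iso0 = {a})"
    using connected_finite_iff_sing by blast
  then obtain a where a: "?b ` carrier Iso0 \<subseteq> {a}" by blast
  have id: "id \<in> carrier (Iso0 :: ('n cproj \<Rightarrow> 'n cproj) monoid)"
    using unitary_in_Iso0[OF unitary_1] by (simp add: proj_action_mat)
  have "?b id = (1 + \<i>) / 4"
    using ij by (simp add: bargmann_two_pt)
  moreover have "?b f = ?b id"
    using subsetD[OF a imageI[OF f]] subsetD[OF a imageI[OF id]] by simp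
  ultimately show ?thesis by simp
qed

text \<open>Polarization: the moduli of \<open>z $ i\<close>, \<open>z $ j\<close>,
  \<open>z $ i + z $ j\<close> and \<open>z $ i - \<i> * z $ j\<close> determine
  \<open>z $ i * cnj (z $ j)\<close>. Hence \<open>z\<close> and \<open>w\<close> have the same
  \<open>outer\<close> matrix and span the same line.\<close>

lemma normalized_fixing_two_pts_is_id:
  fixes f :: "'n::finite cproj \<Rightarrow> 'n cproj"
  assumes f: "normalized f"
    and fix1: "\<And>i j. i \<noteq> j \<Longrightarrow> f (abs_cproj (two_pt i j 1)) = abs_cproj (two_pt i j 1)"
    and fixi: "\<And>i j. i \<noteq> j \<Longrightarrow> f (abs_cproj (two_pt i j \<i>)) = abs_cproj (two_pt i j \<i>)"
  shows "f = id"
proof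
  fix p :: "'n cproj"
  obtain w where w: "w \<noteq> 0" "p = abs_cproj w" using abs_cproj_surj[of 1] by auto
  obtain z where z: "z \<noteq> 0" "f (abs_cproj w) = abs_cproj z" "norm z = norm w"
    and zi: "\<And>i. cmod (z $ i) = cmod (w $ i)"
    using normalized_coordinates[OF f w(1)] by metis
  have iso: "f \<in> isometries" using f by (simp add: normalized_def)
  have eq: "z $ i * cnj (z $ j) = w $ i * cnj (w $ j)" for i j
  proof (cases "i = j")
    case True
    then show ?thesis using zi by (simp add: complex_norm_square[symmetric])
  next
    case False
    have "cmod (z $ i + z $ j) = cmod (w $ i + w $ j)"
      using isometry_cmod_cinner[OF iso w(1) two_pt_nonzero[OF False] z(2) fix1[OF False]] z(3)
      by (simp add: cinner_two_pt)
    moreover have "cmod (z $ i - \<i> * z $ j) = cmod (w $ i - \<i> * w $ j)"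
      using isometry_cmod_cinner[OF iso w(1) two_pt_nonzero[OF False] z(2) fixi[OF False]] z(3)
      by (simp add: cinner_two_pt)
    ultimately have "(cmod (z $ i + z $ j))\<^sup>2 = (cmod (w $ i + w $ j))\<^sup>2"
      "(cmod (z $ i - \<i> * z $ j))\<^sup>2 = (cmod (w $ i - \<i> * w $ j))\<^sup>2"
      "(cmod (z $ i))\<^sup>2 = (cmod (w $ i))\<^sup>2" "(cmod (z $ j))\<^sup>2 = (cmod (w $ j))\<^sup>2"
      using zi by simp_all
    then show ?thesis
      unfolding cmod_power2 complex_eq_iff by (simp add: power2_eq_square algebra_simps)
  qed
  obtain k where k: "w $ k \<noteq> 0" using w(1) by (auto simp: vec_eq_iff)
  then have zk: "z $ k \<noteq> 0" using zi[of k] by auto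
  have "z = (cnj (w $ k) / cnj (z $ k)) *s w"
    using eq[of _ k] zk by (simp add: vec_eq_iff field_simps)
  then have "abs_cproj w = abs_cproj z" using abs_cproj_eq_iff[OF w(1) z(1)] by blast
  then show "f p = id p" using w z by simp
qed

lemma carrier_Iso0_eq: "carrier (Iso0 :: ('n::finite cproj \<Rightarrow> 'n cproj) monoid) = proj_action ` unitary"
proof
  show "proj_action ` unitary \<subseteq> carrier (Iso0 :: ('n cproj \<Rightarrow> 'n cproj) monoid)"
    using unitary_in_Iso0 by blast
  show "carrier (Iso0 :: ('n cproj \<Rightarrow> 'n cproj) monoid) \<subseteq> proj_action ` unitary"
  proof
    fix f :: "'n cproj \<Rightarrow> 'n cproj" assume f: "f \<in> carrier Iso0"
    obtain A where A: "A \<in> unitary" "normalized (proj_action A \<circ> f)"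
      using normalize_isometry[OF Iso0_imp_isometry[OF f]] by metis
    have "(proj_action A \<circ> f) (abs_cproj (two_pt i j 1)) = abs_cproj (two_pt i j 1) \<and>
      (proj_action A \<circ> f) (abs_cproj (two_pt i j \<i>)) = abs_cproj (two_pt i j \<i>)"
      if "i \<noteq> j" for i j
    proof -
      \<comment> \<open>The unitary factor preserves the invariant known for \<open>f\<close>, so
        comparing the two formulas excludes \<open>d = - \<i>\<close> for every pair of
        indices.\<close>
      have "(1 + d) / 4 = (1 + \<i>) / 4 \<longleftrightarrow> d = \<i>" for d by simp
      then show ?thesis
        using normalized_bargmann[OF A(2) that] Iso0_bargmann[OF f that]
        by (metis (no_types, lifting) bargmann_unitary[OF A(1)] comp_apply)
    qed
    then have "proj_action A \<circ> f = id"
      by (intro normalized_fixing_two_pts_is_id A) auto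
    then have "f = proj_action (adjoint_mat A)"
      by (metis A(1) comp_assoc comp_id id_comp proj_action_adjoint(2))
    then show "f \<in> proj_action ` unitary" using unitary_adjoint[OF A(1)] by blast
  qed
qed


section \<open>Group operations of the identity component\<close>

lemma mult_Iso0: "x \<otimes>\<^bsub>Iso0\<^esub> y = x \<circ> y"
  by (simp add: Iso0_def isometry_group_def)

lemma one_Iso0: "\<one>\<^bsub>Iso0\<^esub> = id"
  by (simp add: Iso0_def isometry_group_def)

text \<open>\<open>Iso0\<close> is only a record with a shrunken carrier; closure under products and
  inverses is read off from the unitary description of that carrier.\<close>

lemma group_Iso0: "group (Iso0 :: ('n::finite cproj \<Rightarrow> 'n cproj) monoid)"
proof (rule groupI)
  fix f :: "'n cproj \<Rightarrow> 'n cproj" assume "f \<in> carrier Iso0"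
  then obtain A where A: "A \<in> unitary" "f = proj_action A" by (auto simp: carrier_Iso0_eq)
  then have "proj_action (adjoint_mat A) \<circ> f = id" by (simp add: proj_action_adjoint)
  then show "\<exists>g\<in>carrier Iso0. g \<otimes>\<^bsub>Iso0\<^esub> f = \<one>\<^bsub>Iso0\<^esub>"
    using unitary_in_Iso0[OF unitary_adjoint[OF A(1)]] by (auto simp: mult_Iso0 one_Iso0)
next
  fix f g :: "'n cproj \<Rightarrow> 'n cproj" assume "f \<in> carrier Iso0" "g \<in> carrier Iso0"
  then obtain A B where "A \<in> unitary" "f = proj_action A" "B \<in> unitary" "g = proj_action B"
    by (auto simp: carrier_Iso0_eq)
  then show "f \<otimes>\<^bsub>Iso0\<^esub> g \<in> carrier Iso0"
    using unitary_in_Iso0[OF unitary_mult[of A B]] by (simp add: mult_Iso0 proj_action_mult)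
next
  show "\<one>\<^bsub>Iso0\<^esub> \<in> carrier (Iso0 :: ('n cproj \<Rightarrow> 'n cproj) monoid)"
    using unitary_in_Iso0[OF unitary_1] by (simp add: one_Iso0 proj_action_mat)
qed (auto simp: mult_Iso0 one_Iso0 comp_assoc)

lemma inv_Iso0:
  assumes "A \<in> unitary" shows "inv\<^bsub>Iso0\<^esub> (proj_action A) = proj_action (adjoint_mat A)"
  by (rule group.inv_equality[OF group_Iso0])
    (simp_all add: mult_Iso0 one_Iso0 assms proj_action_adjoint unitary_in_Iso0 unitary_adjoint)

lemma connectedin_Iso0_top:
  "connectedin Iso0_top H \<longleftrightarrow> connectedin compact_open H \<and> H \<subseteq> carrier Iso0"
  by (simp add: Iso0_top_def connectedin_subtopology)

section \<open>Commuting lifts\<close>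

text \<open>The sum is the trace of \<open>B\<close> times the projection. On an eigenvector it is
  the eigenvalue, now written as a function of the point alone.\<close>

lemma eigenvalue_by_proj_mat:
  assumes "norm x = 1"
  shows "(\<Sum>i\<in>UNIV. \<Sum>j\<in>UNIV. B $ i $ j * proj_mat (abs_cproj x) $ j $ i) = cinner (B *v x) x"
  using assms
  by (simp add: proj_mat_unit outer_def cinner_def matrix_vector_mult_def sum_distrib_right mult.assoc)

text \<open>If lifts of \<open>h, k \<in> H\<close> satisfy \<open>A B = z B A\<close>, then \<open>A\<close> maps the \<open>c\<close>-eigenspace of \<open>B\<close>
  to its \<open>c / z\<close>-eigenspace, where \<open>z\<close> is a root of unity. So on a fixed point of \<open>k\<close> the
  eigenvalue moves continuously with \<open>h\<close> within a finite set, and \<open>h = id\<close> gives \<open>c\<close>.\<close>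

lemma lifts_commute:
  fixes H :: "('n::finite cproj \<Rightarrow> 'n cproj) set"
  assumes H: "connected_abelian_subgroup Iso0 Iso0_top H"
    and A: "A \<in> unitary" "proj_action A \<in> H" and B: "B \<in> unitary" "proj_action B \<in> H"
  shows "A ** B = B ** A"
proof -
  have sub: "subgroup H Iso0" and conn: "connectedin compact_open H"
    and ab: "\<And>x y. x \<in> H \<Longrightarrow> y \<in> H \<Longrightarrow> x \<circ> y = y \<circ> x"
    using H by (auto simp: connected_abelian_subgroup_def connectedin_Iso0_top mult_Iso0)
  have "\<exists>g :: 'n \<Rightarrow> complex^'n. orthonormal_on UNIV g \<and> (\<forall>i. \<exists>c. B *v g i = c *s g i)"
    by (rule commuting_unitary_eigenbasis[of "{B}"]) (use B in auto)
  then obtain g :: "'n \<Rightarrow> complex^'n" and c i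
    where g: "orthonormal_on UNIV g" and "B *v g i = c *s g i" by blast
  define u where "u = g i"
  have Bu: "B *v u = c *s u" using \<open>B *v g i = c *s g i\<close> by (simp add: u_def)
  have uu: "cinner u u = 1" using g by (simp add: u_def orthonormal_on_def)
  then have nu: "norm u = 1"
    by (metis cinner_self norm_ge_zero of_real_1 of_real_eq_iff power2_eq_1_iff zero_le_one
        not_one_le_zero neg_0_le_iff_le)
  have "cmod c = 1" using unitary_norm[OF B(1), of u] by (simp add: Bu norm_scale_vec nu)
  then have c: "c \<noteq> 0" by auto
  define ev where "ev p = (\<Sum>i\<in>UNIV. \<Sum>j\<in>UNIV. B $ i $ j * proj_mat p $ j $ i)" for p
  define R where "R = {z :: complex. z ^ CARD('n) = 1}"
  have key: "\<exists>z\<in>R. z \<noteq> 0 \<and> C ** B = mat z ** (B ** C) \<and> ev (proj_action C (abs_cproj u)) = c / z"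
    if C: "C \<in> unitary" "proj_action C \<in> H" for C
  proof -
    have "proj_action (C ** B) = proj_action (B ** C)"
      using ab[OF C(2) B(2)] by (simp add: proj_action_mult B C)
    then obtain z where z: "cmod z = 1" "C ** B = mat z ** (B ** C)"
      using proj_action_eq_imp_scalar[OF unitary_mult[OF C(1) B(1)] unitary_mult[OF B(1) C(1)]] by metis
    have z0: "z \<noteq> 0" using z(1) by auto
    have "det D \<noteq> 0" if "D \<in> unitary" for D :: "complex^'n^'n"
      using unitaryD(1)[OF that] by (metis det_I det_mul mult_zero_left zero_neq_one)
    \<comment> \<open>Determinants of the two sides of \<open>C ** B = mat z ** (B ** C)\<close>;
      cancelling the nonzero \<open>det B * det C\<close> makes \<open>z\<close> a root of
      unity.\<close>
    moreover have "det C * det B = z ^ CARD('n) * (det B * det C)"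
      using arg_cong[OF z(2), of det] by (simp add: det_mul det_mat_scalar)
    ultimately have "z \<in> R" using B(1) C(1) by (simp add: R_def)
    have "z *s (B *v (C *v u)) = (mat z ** (B ** C)) *v u"
      by (simp add: mat_vec flip: matrix_vector_mul_assoc)
    also have "\<dots> = c *s (C *v u)"
      by (simp add: vector_scalar_commute Bu flip: z(2) matrix_vector_mul_assoc)
    finally have "B *v (C *v u) = (c / z) *s (C *v u)"
      using z0 by (simp add: vec_eq_iff field_simps)
    moreover have "cinner (C *v u) (C *v u) = 1" by (simp add: unitary_cinner C uu)
    moreover have "u \<noteq> 0" using nu by auto
    ultimately have "ev (proj_action C (abs_cproj u)) = c / z"
      using eigenvalue_by_proj_mat[of "C *v u" B] C(1) nu
      by (simp add: ev_def proj_action_unitary unitary_norm cinner_scale_left)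
    with \<open>z \<in> R\<close> z(2) z0 show ?thesis by blast
  qed
  define e where "e h = ev (h (abs_cproj u))" for h :: "'n cproj \<Rightarrow> 'n cproj"
  have "continuous_map euclidean euclidean ev"
    unfolding ev_def by simp (intro continuous_intros continuous_on_proj_mat)
  from continuous_map_compose[OF continuous_map_compact_open_eval this]
  have "continuous_map compact_open euclidean e" by (simp add: e_def[abs_def] comp_def)
  then have "connected (e ` H)"
    using connectedin_continuous_map_image[OF _ conn] by force
  moreover have "finite R" unfolding R_def by (rule finite_roots_unity) simp
  moreover have "e ` H \<subseteq> (\<lambda>z. c / z) ` R"
  proof (rule image_subsetI)
    fix h assume "h \<in> H"
    then obtain C where C: "C \<in> unitary" "h = proj_action C"
      using subgroup.subset[OF sub] by (auto simp: carrier_Iso0_eq)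
    then show "e h \<in> (\<lambda>z. c / z) ` R" using key[OF C(1)] \<open>h \<in> H\<close> by (auto simp: e_def)
  qed
  ultimately have "finite (e ` H)" "connected (e ` H)" by (auto intro: finite_subset[OF _ finite_imageI])
  then obtain a where "e ` H \<subseteq> {a}"
    using connected_finite_iff_sing[of "e ` H"] by auto
  moreover have "id \<in> H" using subgroup.one_closed[OF sub] by (simp add: one_Iso0)
  ultimately have "e (proj_action A) = e id" using A(2) by auto
  also have "e id = c"
    by (simp add: e_def ev_def eigenvalue_by_proj_mat nu Bu cinner_scale_left uu)
  finally have "ev (proj_action A (abs_cproj u)) = c" by (simp add: e_def)
  then obtain z where "z \<noteq> 0" "c / z = c" "A ** B = mat z ** (B ** A)"
    using key[OF A] by auto
  then show ?thesis using c by (simp add: field_simps)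
qed

section \<open>The diagonal torus\<close>

lemma diagonal_torus_eq: "(diagonal_torus :: ('n::finite cproj \<Rightarrow> 'n cproj) set) =
    range (\<lambda>\<theta>. proj_action (diag_cis \<theta>))" (is "?T = ?R")
proof
  show "?T \<subseteq> ?R"
  proof
    fix h assume "h \<in> ?T"
    then obtain A :: "complex^'n^'n" where A: "A \<in> unitary" "\<And>i j. i \<noteq> j \<Longrightarrow> A $ i $ j = 0" "h = proj_action A"
      by (auto simp: diagonal_torus_def diagonal_SU_def SU_def unitary_def)
    then obtain \<theta> where "A = diag_cis \<theta>" using unitary_diagonal_cis by metis
    then show "h \<in> ?R" using A(3) by blast
  qed
  show "?R \<subseteq> ?T"
  proof (rule image_subsetI)
    fix \<theta> :: "real^'n"
    \<comment> \<open>Subtracting the mean angle makes the determinant 1; the scalar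
      \<open>cis s\<close> split off acts trivially.\<close>
    define s where "s = (\<Sum>i\<in>UNIV. \<theta> $ i) / CARD('n)"
    define \<eta> where "\<eta> = (\<chi> i. \<theta> $ i - s)"
    have "det (diag_cis \<eta>) = (\<Prod>i\<in>UNIV. cis (\<eta> $ i))"
      by (subst det_diagonal) (auto simp: diag_cis_def diag_mat_def)
    also have "\<dots> = cis (\<Sum>i\<in>UNIV. \<eta> $ i)"
      by (simp add: cis_conv_exp exp_sum sum_distrib_left)
    also have "(\<Sum>i\<in>UNIV. \<eta> $ i) = 0"
      by (simp add: \<eta>_def s_def sum_subtractf)
    finally have "det (diag_cis \<eta>) = 1" by simp
    then have "diag_cis \<eta> \<in> diagonal_SU"
      using diag_cis_unitary[of \<eta>]
      by (auto simp: diagonal_SU_def SU_def unitary_def) (simp add: diag_cis_def diag_mat_def)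
    moreover have "diag_cis \<theta> = mat (cis s) ** diag_cis \<eta>"
      by (simp add: vec_eq_iff mat_mult_component) (simp add: diag_cis_def diag_mat_def \<eta>_def cis_mult)
    then have "proj_action (diag_cis \<theta>) = proj_action (diag_cis \<eta>)"
      by (simp add: proj_action_scale diag_cis_unitary)
    ultimately show "proj_action (diag_cis \<theta>) \<in> diagonal_torus"
      by (auto simp: diagonal_torus_def)
  qed
qed

lemma connected_abelian_diagonal_torus:
  "connected_abelian_subgroup Iso0 Iso0_top (diagonal_torus :: ('n::finite cproj \<Rightarrow> 'n cproj) set)"
proof -
  have sub: "diagonal_torus \<subseteq> carrier (Iso0 :: ('n cproj \<Rightarrow> 'n cproj) monoid)"
    by (auto simp: diagonal_torus_eq intro: unitary_in_Iso0 diag_cis_unitary)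
  have "subgroup diagonal_torus (Iso0 :: ('n cproj \<Rightarrow> 'n cproj) monoid)"
  proof (rule group.subgroupI[OF group_Iso0 sub])
    fix a b :: "'n cproj \<Rightarrow> 'n cproj"
    assume "a \<in> diagonal_torus"
    then obtain \<theta> where a: "a = proj_action (diag_cis \<theta>)" by (auto simp: diagonal_torus_eq)
    then show "inv\<^bsub>Iso0\<^esub> a \<in> diagonal_torus"
      by (auto simp: inv_Iso0 diag_cis_unitary adjoint_diag_cis diagonal_torus_eq)
    assume "b \<in> diagonal_torus"
    then obtain \<eta> where b: "b = proj_action (diag_cis \<eta>)" by (auto simp: diagonal_torus_eq)
    show "a \<otimes>\<^bsub>Iso0\<^esub> b \<in> diagonal_torus"
      by (auto simp: a b mult_Iso0 diag_cis_unitary diag_cis_add diagonal_torus_eq simp flip: proj_action_mult)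
  qed (simp add: diagonal_torus_eq)
  moreover have "connectedin Iso0_top (diagonal_torus :: ('n cproj \<Rightarrow> 'n cproj) set)"
    using connectedin_conj_diag_cis[OF unitary_1] sub
    by (simp add: connectedin_Iso0_top diagonal_torus_eq adjoint_mat_scalar)
  ultimately show ?thesis
    by (auto simp: connected_abelian_subgroup_def diagonal_torus_eq mult_Iso0 diag_cis_unitary
        diag_cis_add add.commute simp flip: proj_action_mult)
qed

section \<open>Conjugation and the transport of MASGs\<close>

definition conj_by :: "complex^'n^'n \<Rightarrow> ('n::finite cproj \<Rightarrow> 'n cproj) \<Rightarrow> 'n cproj \<Rightarrow> 'n cproj" where
  "conj_by A h = proj_action A \<circ> h \<circ> proj_action (adjoint_mat A)"

lemma conj_by_Iso0:
  assumes "A \<in> unitary"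
  shows "proj_action A \<otimes>\<^bsub>Iso0\<^esub> h \<otimes>\<^bsub>Iso0\<^esub> inv\<^bsub>Iso0\<^esub> (proj_action A) = conj_by A h"
  by (simp add: mult_Iso0 inv_Iso0 assms conj_by_def)

lemma conj_by_adjoint:
  assumes "A \<in> unitary"
  shows "conj_by (adjoint_mat A) (conj_by A h) = h" "conj_by A (conj_by (adjoint_mat A) h) = h"
proof -
  have assoc: "p \<circ> (q \<circ> h \<circ> p) \<circ> q = (p \<circ> q) \<circ> h \<circ> (p \<circ> q)" for p q
    by (simp add: comp_assoc)
  show "conj_by (adjoint_mat A) (conj_by A h) = h" "conj_by A (conj_by (adjoint_mat A) h) = h"
    unfolding conj_by_def adjoint_mat_involutive by (subst assoc, simp add: proj_action_adjoint assms)+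
qed

lemma conj_by_proj_action:
  "A \<in> unitary \<Longrightarrow> B \<in> unitary \<Longrightarrow> conj_by A (proj_action B) = proj_action (A ** B ** adjoint_mat A)"
  by (simp add: conj_by_def proj_action_mult unitary_mult unitary_adjoint)

lemma conj_by_mult:
  assumes "A \<in> unitary"
  shows "conj_by A (g \<circ> h) = conj_by A g \<circ> conj_by A h"
proof -
  have "conj_by A g \<circ> conj_by A h = proj_action A \<circ> g \<circ> (proj_action (adjoint_mat A) \<circ> proj_action A) \<circ> h
      \<circ> proj_action (adjoint_mat A)"
    by (simp only: conj_by_def comp_assoc)
  then show ?thesis by (simp add: proj_action_adjoint assms) (simp add: conj_by_def comp_assoc)
qed

lemma conj_by_hom: "A \<in> unitary \<Longrightarrow> conj_by A \<in> hom Iso0 Iso0"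
  by (rule homI) (auto simp: carrier_Iso0_eq mult_Iso0 conj_by_mult conj_by_proj_action
      intro!: imageI unitary_mult unitary_adjoint)

lemma conj_by_connected_abelian:
  fixes H :: "('n::finite cproj \<Rightarrow> 'n cproj) set"
  assumes A: "A \<in> unitary" and H: "connected_abelian_subgroup Iso0 Iso0_top H"
  shows "connected_abelian_subgroup Iso0 Iso0_top (conj_by A ` H)"
proof -
  have "group_hom Iso0 Iso0 (conj_by A)"
    using group_Iso0 conj_by_hom[OF A] by (simp add: group_hom_def group_hom_axioms_def)
  then have sub: "subgroup (conj_by A ` H) Iso0"
    using H by (simp add: connected_abelian_subgroup_def group_hom.subgroup_img_is_subgroup)
  have "continuous_map compact_open compact_open (conj_by A)"
    unfolding conj_by_def[abs_def]
    by (intro continuous_map_compact_open_comp continuous_on_isometry proj_action_isometry A unitary_adjoint)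
  then have "connectedin compact_open (conj_by A ` H)"
    using H by (auto intro: connectedin_continuous_map_image
        simp: connected_abelian_subgroup_def connectedin_Iso0_top)
  then show ?thesis
    using sub H subgroup.subset[OF sub]
    by (auto simp: connected_abelian_subgroup_def connectedin_Iso0_top mult_Iso0 simp flip: conj_by_mult[OF A])
qed

text \<open>A competitor \<open>K\<close> above the conjugate is pulled back by the inverse
  conjugation to a competitor above \<open>H\<close>, where maximality applies.\<close>

lemma conj_by_masg:
  fixes H :: "('n::finite cproj \<Rightarrow> 'n cproj) set"
  assumes A: "A \<in> unitary" and H: "masg Iso0 Iso0_top H"
  shows "masg Iso0 Iso0_top (conj_by A ` H)"
  unfolding masg_def
proof (intro conjI allI impI)
  show "connected_abelian_subgroup Iso0 Iso0_top (conj_by A ` H)"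
    using H A by (simp add: masg_def conj_by_connected_abelian)
  fix K assume K: "connected_abelian_subgroup Iso0 Iso0_top K \<and> conj_by A ` H \<subseteq> K"
  have cancel: "conj_by (adjoint_mat A) ` conj_by A ` L = L" "conj_by A ` conj_by (adjoint_mat A) ` L = L" for L
    by (simp_all add: image_image conj_by_adjoint A)
  have "H \<subseteq> conj_by (adjoint_mat A) ` K"
    using image_mono[of "conj_by A ` H" K "conj_by (adjoint_mat A)"] K by (simp only: cancel)
  then have "conj_by (adjoint_mat A) ` K = H"
    using H K conj_by_connected_abelian[OF unitary_adjoint[OF A]] by (simp add: masg_def)
  then show "K = conj_by A ` H" using cancel(2)[of K] by simp
qed

lemma connected_abelian_conj_into_torus:
  fixes H :: "('n::finite cproj \<Rightarrow> 'n cproj) set"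
  assumes H: "connected_abelian_subgroup Iso0 Iso0_top H"
  obtains A where "A \<in> unitary" "conj_by A ` H \<subseteq> diagonal_torus"
proof -
  \<comment> \<open>The full preimage of \<open>H\<close>: all lifts commute, so no choice of one
    lift per element has to be made.\<close>
  define L where "L = {A \<in> unitary. proj_action A \<in> H}"
  have "\<exists>G \<in> unitary. \<forall>A\<in>L. \<forall>i j. i \<noteq> j \<longrightarrow> (adjoint_mat G ** A ** G) $ i $ j = 0"
    by (rule commuting_unitary_diagonal[of L]) (use lifts_commute[OF H] in \<open>auto simp: L_def\<close>)
  then obtain G where G: "G \<in> unitary"
    "\<forall>A\<in>L. \<forall>i j. i \<noteq> j \<longrightarrow> (adjoint_mat G ** A ** G) $ i $ j = 0" by (rule bexE)
  have "conj_by (adjoint_mat G) h \<in> diagonal_torus" if h: "h \<in> H" for h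
  proof -
    obtain A where A: "A \<in> unitary" "h = proj_action A"
      using H h subgroup.subset by (fastforce simp: connected_abelian_subgroup_def carrier_Iso0_eq)
    then have "A \<in> L" using h by (simp add: L_def)
    have "adjoint_mat G ** A ** G \<in> unitary" by (intro unitary_mult unitary_adjoint A G)
    then have "\<exists>\<theta>. adjoint_mat G ** A ** G = diag_cis \<theta>"
      by (rule unitary_diagonal_cis) (use G(2) \<open>A \<in> L\<close> in auto)
    then obtain \<theta> where "adjoint_mat G ** A ** G = diag_cis \<theta>" ..
    then show ?thesis
      by (simp add: A conj_by_proj_action unitary_adjoint G diagonal_torus_eq)
  qed
  then show ?thesis using that[OF unitary_adjoint[OF G(1)]] by blast
qed

lemma commuting_with_diag_cis:
  assumes "\<And>\<theta>. A ** diag_cis \<theta> = diag_cis \<theta> ** A" "i \<noteq> j"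
  shows "A $ i $ j = 0"
proof -
  \<comment> \<open>This matrix has -1 in position \<open>i\<close> and 1 in position
    \<open>j\<close>, so commuting with it gives \<open>A $ i $ j = - A $ i $ j\<close>.\<close>
  define \<theta> where "\<theta> = (\<chi> k. if k = i then pi else 0)"
  have "(A ** diag_cis \<theta>) $ i $ j = A $ i $ j * cis (\<theta> $ j)"
    by (simp add: matrix_matrix_mult_def diag_cis_def diag_mat_def if_distrib[of "\<lambda>x. _ * x"] cong: if_cong)
  moreover have "(diag_cis \<theta> ** A) $ i $ j = cis (\<theta> $ i) * A $ i $ j"
    by (simp add: matrix_matrix_mult_def diag_cis_def diag_mat_def if_distrib[of "\<lambda>x. x * _"] cong: if_cong)
  ultimately have "A $ i $ j * cis (\<theta> $ j) = cis (\<theta> $ i) * A $ i $ j"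
    using assms(1)[of \<theta>] by metis
  then show ?thesis using assms(2) by (simp add: \<theta>_def)
qed

lemma masg_diagonal_torus: "masg Iso0 Iso0_top (diagonal_torus :: ('n::finite cproj \<Rightarrow> 'n cproj) set)"
  unfolding masg_def
proof (intro conjI allI impI connected_abelian_diagonal_torus)
  fix K :: "('n cproj \<Rightarrow> 'n cproj) set"
  assume "connected_abelian_subgroup Iso0 Iso0_top K \<and> diagonal_torus \<subseteq> K"
  then have K: "connected_abelian_subgroup Iso0 Iso0_top K" "diagonal_torus \<subseteq> K" by auto
  have "h \<in> diagonal_torus" if h: "h \<in> K" for h
  proof -
    obtain A where A: "A \<in> unitary" "h = proj_action A"
      using K(1) h subgroup.subset by (fastforce simp: connected_abelian_subgroup_def carrier_Iso0_eq)
    have "A ** diag_cis \<theta> = diag_cis \<theta> ** A" for \<theta>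
      using K(2) h A by (intro lifts_commute[OF K(1)] diag_cis_unitary) (auto simp: diagonal_torus_eq)
    then obtain \<theta> where "A = diag_cis \<theta>"
      using unitary_diagonal_cis[OF A(1)] commuting_with_diag_cis by metis
    then show ?thesis by (simp add: A(2) diagonal_torus_eq)
  qed
  with K(2) show "K = diagonal_torus" by blast
qed

theorem theorem6p3:
  fixes n :: nat and H :: "('n::finite cproj \<Rightarrow> 'n cproj) set"
  assumes "n \<ge> 1" and "CARD('n) = n + 1"
    and "subgroup H Iso0"
  shows "masg Iso0 Iso0_top H \<longleftrightarrow>
    (\<exists>\<phi> \<in> carrier Iso0.
       (\<lambda>h. \<phi> \<otimes>\<^bsub>Iso0\<^esub> h \<otimes>\<^bsub>Iso0\<^esub> inv\<^bsub>Iso0\<^esub> \<phi>) ` H = diagonal_torus)"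
proof
  assume H: "masg Iso0 Iso0_top H"
  then obtain A where A: "A \<in> unitary" "conj_by A ` H \<subseteq> diagonal_torus"
    using connected_abelian_conj_into_torus by (auto simp: masg_def)
  \<comment> \<open>The conjugate is itself maximal, and the torus is a connected Abelian subgroup
    above it; hence equality.\<close>
  then have "conj_by A ` H = diagonal_torus"
    using conj_by_masg[OF A(1) H] connected_abelian_diagonal_torus unfolding masg_def by blast
  then show "\<exists>\<phi> \<in> carrier Iso0.
      (\<lambda>h. \<phi> \<otimes>\<^bsub>Iso0\<^esub> h \<otimes>\<^bsub>Iso0\<^esub> inv\<^bsub>Iso0\<^esub> \<phi>) ` H = diagonal_torus"
    using A(1) unitary_in_Iso0 by (intro bexI[of _ "proj_action A"]) (simp_all add: conj_by_Iso0)
next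
  assume "\<exists>\<phi> \<in> carrier Iso0.
      (\<lambda>h. \<phi> \<otimes>\<^bsub>Iso0\<^esub> h \<otimes>\<^bsub>Iso0\<^esub> inv\<^bsub>Iso0\<^esub> \<phi>) ` H = diagonal_torus"
  then obtain A where A: "A \<in> unitary" "conj_by A ` H = diagonal_torus"
    by (auto simp: carrier_Iso0_eq conj_by_Iso0)
  have "H = conj_by (adjoint_mat A) ` diagonal_torus"
    unfolding A(2)[symmetric] by (simp add: image_image conj_by_adjoint A(1))
  then show "masg Iso0 Iso0_top H"
    using conj_by_masg[OF unitary_adjoint[OF A(1)] masg_diagonal_torus] by simp
qed

end
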